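(* Let $A\in\mathcal R$ and let $\Gamma_1,\Gamma_2$ be symmetric $d\times d$ matrices with $\Gamma_1\succeq\Gamma_2\succ0$. Then for every $x\in\mathbb R^d$, $$\sum_{k,i,j=1}^d\big|\partial_{kij}\varphi_A(x,\Gamma_1^{1/2})\big|\le\sup_{y\in\mathbb R^d}\sum_{k,i,j=1}^d\big|\partial_{kij}\varphi_A(y,\Gamma_2^{1/2})\big|.$$
   Context: $\mathcal R$ is the class of hyper-rectangles $\prod_{j=1}^d(a_j,b_j]$ in $\mathbb R^d$, $-\infty\le a_j\le b_j\le\infty$. For a positive semidefinite matrix $\Gamma$, $\varphi_A(x,\Gamma^{1/2})=\mathsf P(x+\Gamma^{1/2}\eta\in A)$ with $\eta\sim\mathcal N(0,I_d)$; $\partial_{kij}$ denotes third-order partial derivatives in $x$. *)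

theory Defs
  imports "HOL-Analysis.Analysis" "HOL-Probability.Probability"
begin

text \<open>Hyper-rectangles prod_j (a_j, b_j] with extended-real endpoints, a_j \<le> b_j.\<close>
definition hyperrects :: "(real ^ 'n) set set" where
  "hyperrects = {A. \<exists>a b :: 'n \<Rightarrow> ereal. (\<forall>j. a j \<le> b j) \<and>
      A = {x. \<forall>j. a j < ereal (x $ j) \<and> ereal (x $ j) \<le> b j}}"

definition sym_mat :: "real ^ 'n ^ 'n \<Rightarrow> bool" where
  "sym_mat M \<longleftrightarrow> transpose M = M"

definition psd_mat :: "real ^ 'n ^ 'n \<Rightarrow> bool" where
  "psd_mat M \<longleftrightarrow> sym_mat M \<and> (\<forall>v. 0 \<le> v \<bullet> (M *v v))"

definition pd_mat :: "real ^ 'n ^ 'n \<Rightarrow> bool" where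
  "pd_mat M \<longleftrightarrow> sym_mat M \<and> (\<forall>v. v \<noteq> 0 \<longrightarrow> 0 < v \<bullet> (M *v v))"

text \<open>Loewner order: M1 \<succeq> M2 iff M1 - M2 is positive semidefinite.\<close>
definition loewner_ge :: "real ^ 'n ^ 'n \<Rightarrow> real ^ 'n ^ 'n \<Rightarrow> bool" where
  "loewner_ge M1 M2 \<longleftrightarrow> psd_mat (M1 - M2)"

text \<open>The (unique) symmetric positive semidefinite square root.\<close>
definition psd_sqrt :: "real ^ 'n ^ 'n \<Rightarrow> real ^ 'n ^ 'n" where
  "psd_sqrt M = (THE S. psd_mat S \<and> S ** S = M)"

text \<open>Standard Gaussian measure N(0, I_d) on real^'n.\<close>
definition std_gauss :: "(real ^ 'n) measure" where
  "std_gauss = density lborel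
     (\<lambda>\<eta>. ennreal ((2 * pi) powr (- real CARD('n) / 2) * exp (- (norm \<eta>)\<^sup>2 / 2)))"

text \<open>phi_A(x, S) = P(x + S eta \<in> A), eta ~ N(0, I_d).\<close>
definition phi :: "(real ^ 'n) set \<Rightarrow> real ^ 'n \<Rightarrow> real ^ 'n ^ 'n \<Rightarrow> real" where
  "phi A x S = measure std_gauss {\<eta>. x + S *v \<eta> \<in> A}"

text \<open>Partial derivative in the i-th coordinate direction.\<close>
definition pderiv_coord :: "'n \<Rightarrow> (real ^ 'n \<Rightarrow> real) \<Rightarrow> real ^ 'n \<Rightarrow> real" where
  "pderiv_coord i f x = deriv (\<lambda>t. f (x + t *\<^sub>R axis i 1)) 0"

text \<open>Sum over k,i,j of |\<partial>_kij phi_A(x, S)|.\<close>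
definition third_deriv_sum :: "(real ^ 'n) set \<Rightarrow> real ^ 'n ^ 'n \<Rightarrow> real ^ 'n \<Rightarrow> real" where
  "third_deriv_sum A S x =
     (\<Sum>k\<in>UNIV. \<Sum>i\<in>UNIV. \<Sum>j\<in>UNIV.
        \<bar>pderiv_coord k (pderiv_coord i (pderiv_coord j (\<lambda>y. phi A y S))) x\<bar>)"

end

theory Submission
  imports Defs
begin

text \<open>Write \<open>\<Gamma>1 = \<Gamma>2 + D\<close> with \<open>D\<close> positive semidefinite and \<open>R = D\<^sup>1\<^sup>/\<^sup>2\<close>. For
  independent standard Gaussian vectors \<open>\<eta>\<close> and \<open>\<xi>\<close>, the vector \<open>\<Gamma>2\<^sup>1\<^sup>/\<^sup>2 \<eta> + R \<xi>\<close>
  has the law of \<open>\<Gamma>1\<^sup>1\<^sup>/\<^sup>2 \<eta>\<close> (complete the square in the Gaussian densities), so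
  \<open>\<phi>\<^sub>A(x, \<Gamma>1\<^sup>1\<^sup>/\<^sup>2)\<close> is the average of \<open>\<phi>\<^sub>A(x + R \<xi>, \<Gamma>2\<^sup>1\<^sup>/\<^sup>2)\<close> over \<open>\<xi>\<close>.
  Since \<open>\<Gamma>2\<close> is nondegenerate, \<open>\<phi>\<^sub>A(\<cdot>, \<Gamma>2\<^sup>1\<^sup>/\<^sup>2)\<close> is the integral of a Gaussian
  density over the translates of \<open>A\<close>; differentiating under the integral sign, all its partial
  derivatives are integrals of polynomials times that density, hence bounded, and they may also be
  taken inside the average. So every third derivative for \<open>\<Gamma>1\<close> at \<open>x\<close> is an average of third
  derivatives for \<open>\<Gamma>2\<close>, and the triangle inequality bounds the sum of their absolute values by
  the supremum.\<close>

section \<open>Symmetric matrices\<close>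

lemma sym_mat_inner_mult:
  fixes M :: "real^'n^'n"
  assumes "sym_mat M"
  shows "x \<bullet> (M *v y) = (M *v x) \<bullet> y"
proof -
  have "x \<bullet> (M *v y) = (x v* M) \<bullet> y"
    by (simp add: dot_lmul_matrix)
  also have "x v* M = transpose M *v x"
    by simp
  also have "transpose M = M"
    using assms by (simp add: sym_mat_def)
  finally show ?thesis .
qed

lemma
  fixes A :: "real^'n^'n"
  assumes "det A \<noteq> 0"
  shows matrix_inv_left_det_nz: "matrix_inv A ** A = mat 1"
    and matrix_inv_right_det_nz: "A ** matrix_inv A = mat 1"
proof -
  obtain B where "A ** B = mat 1 \<and> B ** A = mat 1"
    using assms invertible_det_nz unfolding invertible_def by blast
  then have "A ** matrix_inv A = mat 1 \<and> matrix_inv A ** A = mat 1"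
    unfolding matrix_inv_def by (rule someI)
  then show "matrix_inv A ** A = mat 1" "A ** matrix_inv A = mat 1"
    by auto
qed

lemma matrix_inv_mult_vec_cancel:
  fixes A :: "real^'n^'n"
  assumes "det A \<noteq> 0"
  shows "matrix_inv A *v (A *v x) = x" and "A *v (matrix_inv A *v x) = x"
  by (simp_all add: matrix_vector_mul_assoc matrix_inv_left_det_nz matrix_inv_right_det_nz assms)

lemma det_matrix_inv:
  fixes A :: "real^'n^'n"
  assumes "det A \<noteq> 0"
  shows "det (matrix_inv A) = 1 / det A"
proof -
  have "det A * det (matrix_inv A) = 1"
    using matrix_inv_right_det_nz[OF assms] by (metis det_I det_mul)
  then show ?thesis
    using assms by (simp add: field_simps)
qed

section \<open>Spectral decomposition of symmetric matrices\<close>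

lemma nonpos_if_le_pos_multiples:
  fixes a C :: real
  assumes "\<And>s. 0 < s \<Longrightarrow> a \<le> s * C"
  shows "a \<le> 0"
proof (cases "C \<le> 0")
  case True
  with assms[of 1] show ?thesis
    by simp
next
  case False
  show ?thesis
  proof (rule field_le_epsilon)
    fix e :: real
    assume "0 < e"
    with False assms[of "e / C"] show "a \<le> 0 + e"
      by simp
  qed
qed

text \<open>If u maximizes the Rayleigh quotient on an invariant subspace, then moving u in the direction
  of the residual r = (u \<bullet> M u) u - M u increases the quotient to first order in the step unless
  r = 0.\<close>

lemma rayleigh_maximizer_eigenvector:
  fixes M :: "real^'n^'n"
  assumes sym: "sym_mat M" and V: "subspace V" and inv: "\<And>x. x \<in> V \<Longrightarrow> M *v x \<in> V"
    and u: "u \<in> V" "norm u = 1"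
    and max: "\<And>x. x \<in> V \<Longrightarrow> x \<bullet> (M *v x) \<le> (u \<bullet> (M *v u)) * (x \<bullet> x)"
  shows "M *v u = (u \<bullet> (M *v u)) *\<^sub>R u"
proof -
  define l where "l = u \<bullet> (M *v u)"
  define r where "r = l *\<^sub>R u - M *v u"
  have rV: "r \<in> V"
    unfolding r_def using V u inv by (intro subspace_diff subspace_scale) auto
  have uu: "u \<bullet> u = 1"
    using u by (simp add: norm_eq_1)
  have ur: "u \<bullet> r = 0"
    using uu by (simp add: r_def l_def inner_diff_right)
  have rMu: "r \<bullet> (M *v u) = - (r \<bullet> r)"
    using ur by (simp add: r_def inner_diff_right inner_diff_left inner_commute)
  have "r \<bullet> r \<le> s * ((l * (r \<bullet> r) - r \<bullet> (M *v r)) / 2)" if "0 < s" for s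
  proof -
    have "u - s *\<^sub>R r \<in> V"
      using V u rV by (intro subspace_diff subspace_scale) auto
    from max[OF this] have
      "l - 2 * s * (r \<bullet> (M *v u)) + s\<^sup>2 * (r \<bullet> (M *v r)) \<le> l * (1 + s\<^sup>2 * (r \<bullet> r))"
      using sym_mat_inner_mult[OF sym, of u r] uu ur
      by (simp add: l_def matrix_vector_mult_diff_distrib matrix_vector_mult_scaleR inner_diff_left
          inner_diff_right power2_eq_square inner_commute algebra_simps)
    moreover have "l - 2 * s * (r \<bullet> (M *v u)) + s\<^sup>2 * (r \<bullet> (M *v r))
        = l + s * (2 * (r \<bullet> r) + s * (r \<bullet> (M *v r)))"
      by (simp add: rMu power2_eq_square algebra_simps)
    moreover have "l * (1 + s\<^sup>2 * (r \<bullet> r)) = l + s * (s * (l * (r \<bullet> r)))"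
      by (simp add: power2_eq_square algebra_simps)
    ultimately have "s * (2 * (r \<bullet> r) + s * (r \<bullet> (M *v r))) \<le> s * (s * (l * (r \<bullet> r)))"
      by linarith
    then have "2 * (r \<bullet> r) + s * (r \<bullet> (M *v r)) \<le> s * (l * (r \<bullet> r))"
      using that by (rule mult_left_le_imp_le)
    then show ?thesis
      by (simp add: algebra_simps)
  qed
  then have "r \<bullet> r \<le> 0"
    by (rule nonpos_if_le_pos_multiples)
  then have "r = 0"
    by (metis inner_eq_zero_iff inner_ge_zero order_antisym)
  then show ?thesis
    by (simp add: r_def l_def)
qed

lemma eigenvector_in_invariant_subspace:
  fixes M :: "real^'n^'n"
  assumes sym: "sym_mat M" and V: "subspace V" and inv: "\<And>x. x \<in> V \<Longrightarrow> M *v x \<in> V"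
    and x0: "x0 \<in> V" "x0 \<noteq> 0"
  shows "\<exists>u\<in>V. norm u = 1 \<and> (\<exists>\<mu>. M *v u = \<mu> *\<^sub>R u)"
proof -
  define K where "K = V \<inter> sphere 0 1"
  have "compact K"
    unfolding K_def using closed_subspace[OF V] by (simp add: closed_Int_compact)
  moreover have "x0 /\<^sub>R norm x0 \<in> K"
    using x0 V by (simp add: K_def subspace_scale)
  moreover have "continuous_on K (\<lambda>x. x \<bullet> (M *v x))"
    by (intro continuous_intros linear_continuous_on) (simp add: matrix_vector_mul_linear linear_linear)
  ultimately obtain u where u: "u \<in> K" and umax: "\<And>y. y \<in> K \<Longrightarrow> y \<bullet> (M *v y) \<le> u \<bullet> (M *v u)"
    using continuous_attains_sup[of K "\<lambda>x. x \<bullet> (M *v x)"] by blast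
  have "x \<bullet> (M *v x) \<le> (u \<bullet> (M *v u)) * (x \<bullet> x)" if "x \<in> V" for x
  proof (cases "x = 0")
    case False
    have "x /\<^sub>R norm x \<in> K"
      using that False V by (simp add: K_def subspace_scale)
    from umax[OF this] have "(x \<bullet> (M *v x)) / (norm x)\<^sup>2 \<le> u \<bullet> (M *v u)"
      by (simp add: matrix_vector_mult_scaleR power2_eq_square divide_inverse mult_ac)
    then show ?thesis
      using False by (simp add: divide_le_eq power2_norm_eq_inner)
  qed simp
  with rayleigh_maximizer_eigenvector[OF sym V inv] u show ?thesis
    unfolding K_def by auto
qed

definition orthonormal_set :: "'a::real_inner set \<Rightarrow> bool" where
  "orthonormal_set B \<longleftrightarrow> finite B \<and> pairwise orthogonal B \<and> (\<forall>v\<in>B. norm v = 1)"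

lemma orthonormal_set_inner:
  assumes "orthonormal_set B" "v \<in> B" "w \<in> B"
  shows "v \<bullet> w = (if v = w then 1 else 0)"
  using assms by (auto simp: orthonormal_set_def pairwise_def orthogonal_def norm_eq_1)

lemma orthonormal_set_card_le:
  assumes "orthonormal_set (B :: 'a::euclidean_space set)"
  shows "card B \<le> DIM('a)"
proof -
  have "independent B"
    using assms by (intro pairwise_orthogonal_independent) (auto simp: orthonormal_set_def)
  then show ?thesis
    using independent_bound[of B] by simp
qed

lemma sym_mat_orthogonal_eigenvectors_invariant:
  fixes M :: "real^'n^'n"
  assumes sym: "sym_mat M" and eig: "\<And>v. v \<in> B \<Longrightarrow> \<exists>\<mu>. M *v v = \<mu> *\<^sub>R v"
    and x: "\<And>v. v \<in> B \<Longrightarrow> v \<bullet> x = 0" and v: "v \<in> B"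
  shows "v \<bullet> (M *v x) = 0"
proof -
  obtain \<mu> where "M *v v = \<mu> *\<^sub>R v"
    using eig[OF v] by blast
  then show ?thesis
    using sym_mat_inner_mult[OF sym, of v x] x[OF v] by simp
qed

lemma orthonormal_eigenbasis_exists:
  fixes M :: "real^'n^'n"
  assumes sym: "sym_mat M"
  obtains B where "orthonormal_set B" "span B = UNIV" "\<And>v. v \<in> B \<Longrightarrow> \<exists>\<mu>. M *v v = \<mu> *\<^sub>R v"
proof -
  define E where "E = {B. orthonormal_set B \<and> (\<forall>v\<in>B. \<exists>\<mu>. M *v v = \<mu> *\<^sub>R v)}"
  have "{} \<in> E"
    by (simp add: E_def orthonormal_set_def)
  moreover have "\<forall>B. B \<in> E \<longrightarrow> card B < Suc CARD('n)"
    using orthonormal_set_card_le[where 'a="real^'n"] by (auto simp: E_def less_Suc_eq_le)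
  ultimately have "\<exists>B. B \<in> E \<and> (\<forall>B'. B' \<in> E \<longrightarrow> card B' \<le> card B)"
    by (rule ex_has_greatest_nat)
  then obtain B where B: "B \<in> E" and Bmax: "\<And>B'. B' \<in> E \<Longrightarrow> card B' \<le> card B"
    by blast
  have "span B = UNIV"
  proof (rule ccontr)
    assume "span B \<noteq> UNIV"
    then obtain a where a: "a \<noteq> 0" "\<forall>x\<in>span B. a \<bullet> x = 0"
      using span_not_UNIV_orthogonal by blast
    define V where "V = {x. \<forall>v\<in>B. v \<bullet> x = 0}"
    have V: "subspace V"
      by (auto simp: V_def subspace_def inner_add_right)
    have "M *v x \<in> V" if x: "x \<in> V" for x
    proof -
      have "v \<bullet> (M *v x) = 0" if "v \<in> B" for v
        by (rule sym_mat_orthogonal_eigenvectors_invariant[OF sym _ _ that])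
           (use B x in \<open>auto simp: E_def V_def\<close>)
      then show ?thesis
        by (simp add: V_def)
    qed
    moreover have "a \<in> V"
      using a by (auto simp: V_def inner_commute span_base)
    ultimately obtain u where u: "u \<in> V" "norm u = 1" "\<exists>\<mu>. M *v u = \<mu> *\<^sub>R u"
      using eigenvector_in_invariant_subspace[OF sym V] a by blast
    have "u \<notin> B"
      using u by (auto simp: V_def norm_eq_1)
    moreover have "pairwise orthogonal (insert u B)"
      using B u(1) by (auto simp: E_def orthonormal_set_def V_def pairwise_insert orthogonal_def
          inner_commute[of u])
    then have "insert u B \<in> E"
      using B u(2,3) by (simp add: E_def orthonormal_set_def)
    ultimately show False
      using Bmax[of "insert u B"] B by (simp add: E_def orthonormal_set_def)
  qed
  with B show ?thesis
    by (intro that) (auto simp: E_def)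
qed

definition spectral_matrix :: "(real^'n) set \<Rightarrow> (real^'n \<Rightarrow> real) \<Rightarrow> real^'n^'n" where
  "spectral_matrix B c = (\<chi> i j. \<Sum>v\<in>B. c v * v$i * v$j)"

lemma spectral_matrix_mult_vec: "spectral_matrix B c *v x = (\<Sum>v\<in>B. (c v * (v \<bullet> x)) *\<^sub>R v)"
proof -
  have "(spectral_matrix B c *v x) $ i = (\<Sum>v\<in>B. (c v * (v \<bullet> x)) *\<^sub>R v) $ i" for i
  proof -
    have "(spectral_matrix B c *v x) $ i = (\<Sum>j\<in>UNIV. \<Sum>v\<in>B. c v * v$i * v$j * x$j)"
      by (simp add: spectral_matrix_def matrix_vector_mult_def sum_distrib_right)
    also have "\<dots> = (\<Sum>v\<in>B. \<Sum>j\<in>UNIV. c v * v$i * v$j * x$j)"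
      by (rule sum.swap)
    also have "\<dots> = (\<Sum>v\<in>B. (c v * (v \<bullet> x)) *\<^sub>R v) $ i"
      by (simp add: inner_vec_def sum_distrib_left sum_component mult_ac)
    finally show ?thesis .
  qed
  then show ?thesis
    by (simp add: vec_eq_iff)
qed

lemma sym_mat_spectral_matrix: "sym_mat (spectral_matrix B c)"
  by (simp add: sym_mat_def spectral_matrix_def transpose_def vec_eq_iff mult_ac)

lemma inner_spectral_matrix: "x \<bullet> (spectral_matrix B c *v x) = (\<Sum>v\<in>B. c v * (v \<bullet> x)\<^sup>2)"
  by (simp add: spectral_matrix_mult_vec inner_sum_right power2_eq_square inner_commute mult_ac)

lemma spectral_matrix_eigenvector:
  assumes "orthonormal_set B" "v \<in> B"
  shows "spectral_matrix B c *v v = c v *\<^sub>R v"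
proof -
  have "(c w * (w \<bullet> v)) *\<^sub>R w = (if w = v then c v *\<^sub>R v else 0)" if "w \<in> B" for w
    using orthonormal_set_inner[OF assms(1) that assms(2)] by simp
  then have "spectral_matrix B c *v v = (\<Sum>w\<in>B. if w = v then c v *\<^sub>R v else 0)"
    by (simp add: spectral_matrix_mult_vec cong: sum.cong)
  also have "\<dots> = c v *\<^sub>R v"
    using assms by (simp add: orthonormal_set_def)
  finally show ?thesis .
qed

lemma eq_spectral_matrix_if_eigenbasis:
  fixes T :: "real^'n^'n"
  assumes B: "orthonormal_set B" "span B = UNIV" and eig: "\<And>v. v \<in> B \<Longrightarrow> T *v v = c v *\<^sub>R v"
  shows "T = spectral_matrix B c"
proof -
  have "T *v x = spectral_matrix B c *v x" for x
  proof -
    have "x = (\<Sum>v\<in>B. (x \<bullet> v) *\<^sub>R v)"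
      using B by (intro orthonormal_basis_expand[symmetric]) (auto simp: orthonormal_set_def)
    then have "T *v x = (\<Sum>v\<in>B. (x \<bullet> v) *\<^sub>R (T *v v))"
      by (metis (no_types, lifting) linear_sum[OF matrix_vector_mul_linear] matrix_vector_mult_scaleR
          sum.cong)
    also have "\<dots> = spectral_matrix B c *v x"
      by (simp add: spectral_matrix_mult_vec eig inner_commute mult_ac)
    finally show ?thesis .
  qed
  then show ?thesis
    by (simp add: matrix_eq)
qed

section \<open>Square roots of positive semidefinite matrices\<close>

lemma psd_mat_square_root_eigenvector:
  fixes T :: "real^'n^'n"
  assumes T: "psd_mat T" and v: "(T ** T) *v v = \<mu> *\<^sub>R v" and \<mu>: "0 \<le> \<mu>"
  shows "T *v v = sqrt \<mu> *\<^sub>R v"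
proof -
  define w where "w = T *v v - sqrt \<mu> *\<^sub>R v"
  have "T *v w + sqrt \<mu> *\<^sub>R w = (T ** T) *v v - \<mu> *\<^sub>R v"
    using \<mu> by (simp add: w_def matrix_vector_mult_diff_distrib matrix_vector_mult_scaleR
        matrix_vector_mul_assoc algebra_simps real_sqrt_mult[symmetric])
  then have "T *v w = - (sqrt \<mu> *\<^sub>R w)"
    using v by (simp add: eq_neg_iff_add_eq_0)
  then have "w \<bullet> (T *v w) = - sqrt \<mu> * (w \<bullet> w)"
    by simp
  moreover have "0 \<le> w \<bullet> (T *v w)"
    using T by (simp add: psd_mat_def)
  moreover have "0 \<le> sqrt \<mu> * (w \<bullet> w)"
    using \<mu> by simp
  ultimately have "sqrt \<mu> * (w \<bullet> w) = 0"
    by linarith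
  then have "sqrt \<mu> = 0 \<or> w = 0"
    by simp
  then show ?thesis
  proof
    assume "sqrt \<mu> = 0"
    then have "(T *v v) \<bullet> (T *v v) = 0"
      using v sym_mat_inner_mult[of T v "T *v v"] T
      by (simp add: psd_mat_def matrix_vector_mul_assoc)
    then show ?thesis
      using \<open>sqrt \<mu> = 0\<close> by simp
  qed (simp add: w_def)
qed

lemma ex1_psd_sqrt:
  fixes M :: "real^'n^'n"
  assumes psd: "psd_mat M"
  shows "\<exists>!S. psd_mat S \<and> S ** S = M"
proof -
  obtain B where B: "orthonormal_set B" "span B = UNIV"
    and eig: "\<And>v. v \<in> B \<Longrightarrow> \<exists>\<mu>. M *v v = \<mu> *\<^sub>R v"
    using orthonormal_eigenbasis_exists psd unfolding psd_mat_def by blast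
  define \<mu> where "\<mu> v = v \<bullet> (M *v v)" for v
  have M_eig: "M *v v = \<mu> v *\<^sub>R v" if "v \<in> B" for v
    using eig[OF that] orthonormal_set_inner[OF B(1) that that] by (auto simp: \<mu>_def)
  have \<mu>_nonneg: "0 \<le> \<mu> v" for v
    using psd by (simp add: psd_mat_def \<mu>_def)
  define S where "S = spectral_matrix B (\<lambda>v. sqrt (\<mu> v))"
  have S_eig: "S *v v = sqrt (\<mu> v) *\<^sub>R v" if "v \<in> B" for v
    unfolding S_def using B(1) that by (rule spectral_matrix_eigenvector)
  have "psd_mat S"
    using \<mu>_nonneg by (auto simp: psd_mat_def S_def sym_mat_spectral_matrix inner_spectral_matrix
        intro!: sum_nonneg)
  moreover have "S ** S = M"
  proof -
    have "(S ** S) *v v = \<mu> v *\<^sub>R v" if "v \<in> B" for v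
      using that \<mu>_nonneg[of v]
      by (simp add: matrix_vector_mul_assoc[symmetric] S_eig matrix_vector_mult_scaleR)
    then have "S ** S = spectral_matrix B \<mu>"
      by (rule eq_spectral_matrix_if_eigenbasis[OF B])
    also have "\<dots> = M"
      by (rule eq_spectral_matrix_if_eigenbasis[OF B M_eig, symmetric])
    finally show ?thesis .
  qed
  moreover have "T = S" if "psd_mat T" "T ** T = M" for T
    unfolding S_def using B
  proof (rule eq_spectral_matrix_if_eigenbasis)
    show "T *v v = sqrt (\<mu> v) *\<^sub>R v" if "v \<in> B" for v
      using that \<open>psd_mat T\<close> \<open>T ** T = M\<close> M_eig \<mu>_nonneg psd_mat_square_root_eigenvector by blast
  qed
  ultimately show ?thesis
    by blast
qed

lemma
  fixes M :: "real^'n^'n"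
  assumes "psd_mat M"
  shows psd_mat_psd_sqrt: "psd_mat (psd_sqrt M)"
    and psd_sqrt_square: "psd_sqrt M ** psd_sqrt M = M"
  using theI'[OF ex1_psd_sqrt[OF assms]] unfolding psd_sqrt_def by auto

lemma pd_mat_imp_psd_mat: "pd_mat M \<Longrightarrow> psd_mat M"
  unfolding pd_mat_def psd_mat_def by (metis inner_zero_left less_eq_real_def order_refl)

lemma det_psd_sqrt_nz:
  fixes M :: "real^'n^'n"
  assumes "pd_mat M"
  shows "det (psd_sqrt M) \<noteq> 0"
proof -
  let ?S = "psd_sqrt M"
  have "x = 0" if "?S *v x = 0" for x
  proof -
    have "M *v x = 0"
      using that psd_sqrt_square[OF pd_mat_imp_psd_mat[OF assms]]
      by (metis matrix_vector_mul_assoc matrix_vector_mult_0_right)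
    then show ?thesis
      using assms unfolding pd_mat_def by (metis inner_zero_right less_irrefl)
  qed
  then have "inj ((*v) ?S)"
    by (intro injI) (metis eq_iff_diff_eq_0 matrix_vector_mult_diff_distrib)
  then show ?thesis
    using det_nz_iff_inj[OF matrix_vector_mul_linear[of ?S]] by simp
qed

lemma pd_mat_if_loewner_ge:
  fixes M1 M2 :: "real^'n^'n"
  assumes "sym_mat M1" "loewner_ge M1 M2" "pd_mat M2"
  shows "pd_mat M1"
proof -
  have "0 < v \<bullet> (M1 *v v)" if "v \<noteq> 0" for v
  proof -
    have "0 \<le> v \<bullet> ((M1 - M2) *v v)" "0 < v \<bullet> (M2 *v v)"
      using assms that by (simp_all add: loewner_ge_def psd_mat_def pd_mat_def)
    then show ?thesis
      by (simp add: matrix_vector_mult_diff_rdistrib inner_diff_right)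
  qed
  then show ?thesis
    using assms(1) by (simp add: pd_mat_def)
qed

section \<open>The standard Gaussian measure\<close>

definition gauss_density :: "real^'n \<Rightarrow> real" where
  "gauss_density \<eta> = (2 * pi) powr (- real CARD('n) / 2) * exp (- (norm \<eta>)\<^sup>2 / 2)"

lemma gauss_density_nonneg[simp]: "0 \<le> gauss_density x"
  by (simp add: gauss_density_def)

lemma gauss_density_measurable[measurable]: "gauss_density \<in> borel_measurable borel"
  unfolding gauss_density_def by measurable

lemma std_gauss_density: "std_gauss = density lborel (\<lambda>x. ennreal (gauss_density x))"
  by (simp add: std_gauss_def gauss_density_def)

lemma norm_power2_Basis: "(norm (x::'a::euclidean_space))\<^sup>2 = (\<Sum>b\<in>Basis. (x \<bullet> b)\<^sup>2)"
  unfolding power2_norm_eq_inner by (subst euclidean_inner) (simp add: power2_eq_square)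

lemma gauss_density_prod: "gauss_density (x::real^'n) = (\<Prod>b\<in>Basis. std_normal_density (x \<bullet> b))"
proof -
  have "(\<Prod>b\<in>(Basis::(real^'n) set). std_normal_density (x \<bullet> b))
     = (\<Prod>b\<in>(Basis::(real^'n) set). (1 / sqrt (2 * pi))) * (\<Prod>b\<in>(Basis::(real^'n) set). exp (- (x \<bullet> b)\<^sup>2 / 2))"
    by (simp only: std_normal_density_def prod.distrib)
  also have "(\<Prod>b\<in>(Basis::(real^'n) set). exp (- (x \<bullet> b)\<^sup>2 / 2)) = exp (- (norm x)\<^sup>2 / 2)"
    by (simp add: exp_sum[symmetric] norm_power2_Basis sum_divide_distrib sum_negf)
  also have "(\<Prod>b\<in>(Basis::(real^'n) set). (1 / sqrt (2 * pi))) = (2 * pi) powr (- real CARD('n) / 2)"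
  proof -
    have "(\<Prod>b\<in>(Basis::(real^'n) set). (1 / sqrt (2 * pi))) = (1 / sqrt (2 * pi)) ^ CARD('n)"
      by (simp add: prod_constant)
    also have "\<dots> = ((2 * pi) powr (- 1 / 2)) ^ CARD('n)"
      by (simp add: powr_minus_divide powr_half_sqrt)
    also have "\<dots> = (2 * pi) powr (- real CARD('n) / 2)"
      by (simp add: powr_realpow[symmetric] powr_powr)
    finally show ?thesis .
  qed
  finally show ?thesis
    by (simp add: gauss_density_def)
qed

lemma nn_integral_gauss_density: "(\<integral>\<^sup>+x. ennreal (gauss_density (x::real^'n)) \<partial>lborel) = 1"
proof -
  interpret product_sigma_finite "\<lambda>_::real^'n. lborel::real measure" by standard
  have "(\<integral>\<^sup>+x. ennreal (gauss_density (x::real^'n)) \<partial>lborel)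
      = (\<integral>\<^sup>+f. ennreal (gauss_density (\<Sum>b\<in>Basis. f b *\<^sub>R b :: real^'n)) \<partial>(\<Pi>\<^sub>M b\<in>Basis. lborel))"
    by (subst lborel_eq) (simp add: nn_integral_distr)
  also have "\<dots> = (\<integral>\<^sup>+f. (\<Prod>b\<in>(Basis::(real^'n) set). ennreal (std_normal_density (f b))) \<partial>(\<Pi>\<^sub>M b\<in>Basis. lborel))"
    by (intro nn_integral_cong)
       (simp add: gauss_density_prod inner_sum_left inner_Basis if_distrib prod_ennreal cong: if_cong)
  also have "\<dots> = (\<Prod>b\<in>(Basis::(real^'n) set). (\<integral>\<^sup>+t. ennreal (std_normal_density t) \<partial>lborel))"
    by (rule product_nn_integral_prod) auto
  also have "\<dots> = 1"
  proof -
    have "prob_space (density lborel (std_normal_density))"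
      by (rule prob_space_normal_density) simp
    then have "emeasure (density lborel (std_normal_density)) UNIV = 1"
      using prob_space.emeasure_space_1 by fastforce
    then have "(\<integral>\<^sup>+t. ennreal (std_normal_density t) \<partial>lborel) = 1"
      by (simp add: emeasure_density)
    then show ?thesis
      by simp
  qed
  finally show ?thesis .
qed

lemma prob_space_std_gauss: "prob_space (std_gauss :: (real^'n) measure)"
proof
  show "emeasure std_gauss (space std_gauss) = 1"
    by (simp add: std_gauss_density emeasure_density nn_integral_gauss_density)
qed

lemma sets_std_gauss[simp, measurable_cong]: "sets (std_gauss :: (real^'n) measure) = sets borel"
  by (simp add: std_gauss_density)

section \<open>Linear changes of variables\<close>

lemma matrix_vector_mult_measurable[measurable]:
  fixes A :: "real^'n^'m"
  shows "((*v) A) \<in> borel \<rightarrow>\<^sub>M borel"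
  by (intro borel_measurable_continuous_onI linear_continuous_on) (simp add: matrix_vector_mul_linear linear_linear)

lemma lborel_eq_density_distr_matrix_wellorder:
  fixes A :: "real^'k::{finite,wellorder}^'k::_"
  assumes dA: "det A \<noteq> 0"
  shows "lborel = density (distr lborel borel ((*v) A)) (\<lambda>_. ennreal \<bar>det A\<bar>)"
proof (rule lborel_eqI)
  fix l u :: "real^'k::{finite,wellorder}"
  assume le: "\<And>b. b \<in> Basis \<Longrightarrow> l \<bullet> b \<le> u \<bullet> b"
  let ?B = "matrix_inv A"
  have pre: "(*v) A -` box l u = (*v) ?B ` box l u"
  proof (intro set_eqI iffI)
    fix x assume "x \<in> (*v) A -` box l u"
    then show "x \<in> (*v) ?B ` box l u"
      using matrix_inv_mult_vec_cancel(1)[OF dA, of x] by (metis image_eqI vimageE)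
  next
    fix x assume "x \<in> (*v) ?B ` box l u"
    then show "x \<in> (*v) A -` box l u"
      using matrix_inv_mult_vec_cancel(2)[OF dA] by auto
  qed
  have lin: "linear ((*v) ?B)"
    by (simp add: matrix_vector_mul_linear)
  have lm: "box l u \<in> lmeasurable"
    by simp
  have bor: "(*v) A -` box l u \<in> sets borel"
    using measurable_sets_borel[OF matrix_vector_mult_measurable[of A], of "box l u"] by simp
  have "emeasure lborel ((*v) A -` box l u) = emeasure lebesgue ((*v) ?B ` box l u)"
    using bor by (simp add: emeasure_completion pre)
  also have "\<dots> = ennreal (measure lebesgue ((*v) ?B ` box l u))"
    by (rule emeasure_eq_measure2[OF measurable_linear_image[OF lin lm]])
  also have "\<dots> = ennreal (\<bar>det ?B\<bar> * measure lebesgue (box l u))"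
    using measure_linear_image[OF lin lm] unfolding matrix_of_matrix_vector_mul by simp
  finally have preimage: "emeasure lborel ((*v) A -` box l u) = ennreal (\<bar>det ?B\<bar> * measure lebesgue (box l u))" .
  have "emeasure (density (distr lborel borel ((*v) A)) (\<lambda>_. ennreal \<bar>det A\<bar>)) (box l u)
      = ennreal \<bar>det A\<bar> * emeasure lborel ((*v) A -` box l u)"
    by (simp add: emeasure_density emeasure_distr bor nn_integral_cmult_indicator)
  also have "\<dots> = ennreal (measure lebesgue (box l u))"
  proof -
    have "\<bar>det A\<bar> * (\<bar>det ?B\<bar> * measure lebesgue (box l u)) = measure lebesgue (box l u)"
      using dA by (simp add: det_matrix_inv abs_mult)
    then show ?thesis
      by (simp only: preimage ennreal_mult'[symmetric] abs_ge_zero)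
  qed
  also have "\<dots> = (\<Prod>b\<in>Basis. (u - l) \<bullet> b)"
    using le by (simp add: emeasure_lborel_box_eq measure_def)
  finally show "emeasure (density (distr lborel borel ((*v) A)) (\<lambda>_. ennreal \<bar>det A\<bar>)) (box l u)
      = (\<Prod>b\<in>Basis. (u - l) \<bullet> b)" .
qed simp

lemma prod_Basis_vec: "(\<Prod>b\<in>(Basis :: (real^'n) set). f b) = (\<Prod>k\<in>UNIV. f (axis k 1))"
proof -
  have "(Basis :: (real^'n) set) = range (\<lambda>k. axis k 1)"
    by (auto simp: Basis_vec_def)
  moreover have "inj (\<lambda>k::'n. axis k (1::real))"
    by (simp add: inj_on_def axis_eq_axis)
  ultimately show ?thesis
    using prod.reindex[of "\<lambda>k::'n. axis k (1::real)" UNIV f] by simp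
qed

lemma vec_reindex_measurable[measurable]:
  "(\<lambda>x::real^'n. \<chi> k. x $ \<sigma> k) \<in> borel_measurable borel"
  by (intro borel_measurable_continuous_onI continuous_on_vec_lambda continuous_on_component
      continuous_on_id)

lemma lborel_distr_vec_reindex:
  fixes \<sigma> :: "'k::finite \<Rightarrow> 'n::finite"
  assumes \<sigma>: "bij \<sigma>"
  shows "distr lborel borel (\<lambda>x::real^'n. \<chi> k. x $ \<sigma> k) = (lborel :: (real^'k) measure)"
proof (rule lborel_eqI[symmetric])
  fix l u :: "real^'k" assume le: "\<And>b. b \<in> Basis \<Longrightarrow> l \<bullet> b \<le> u \<bullet> b"
  let ?Q = "\<lambda>y::real^'k. \<chi> n. y $ inv \<sigma> n"
  have "(\<forall>k. P (\<sigma> k)) \<longleftrightarrow> (\<forall>n. P n)" for P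
    using \<sigma> by (metis bij_pointE)
  from this[of "\<lambda>n. l $ inv \<sigma> n < x $ n \<and> x $ n < u $ inv \<sigma> n" for x]
  have "x \<in> box (?Q l) (?Q u) \<longleftrightarrow> (\<forall>k. l $ k < x $ \<sigma> k \<and> x $ \<sigma> k < u $ k)" for x
    using \<sigma> by (simp add: mem_box_cart bij_is_inj)
  then have "(\<lambda>x. \<chi> k. x $ \<sigma> k) -` box l u = box (?Q l) (?Q u)"
    by (auto simp: mem_box_cart)
  moreover have "(\<Prod>n\<in>UNIV. u $ inv \<sigma> n - l $ inv \<sigma> n) = (\<Prod>k\<in>UNIV. u $ k - l $ k)"
    using \<sigma> by (intro prod.reindex_bij_betw) (simp add: bij_imp_bij_inv)
  moreover have "l $ k \<le> u $ k" for k
  proof -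
    have "axis k (1::real) \<in> Basis"
      by (auto simp: Basis_vec_def)
    from le[OF this] show ?thesis
      by (simp add: cart_eq_inner_axis)
  qed
  then have "?Q l \<bullet> b \<le> ?Q u \<bullet> b" if "b \<in> Basis" for b
    using that by (auto simp: Basis_vec_def inner_axis)
  ultimately show "emeasure (distr lborel borel (\<lambda>x::real^'n. \<chi> k. x $ \<sigma> k)) (box l u)
      = (\<Prod>b\<in>Basis. (u - l) \<bullet> b)"
    by (simp add: emeasure_distr emeasure_lborel_box prod_Basis_vec inner_axis)
qed simp

text \<open>The linear change of variables formula of \<^theory>\<open>HOL-Analysis.Change_Of_Vars\<close> is
  stated for index types of sort \<^class>\<open>wellorder\<close> only. The type \<open>'n ord_index\<close> is a
  well-ordered copy of an arbitrary finite index type \<open>'n\<close>; relabelling coordinates along a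
  bijection transfers the formula.\<close>

typedef ('n::finite) ord_index = "{..<CARD('n)}"
  by (rule exI[of _ 0]) simp

instantiation ord_index :: (finite) "{finite, wellorder}"
begin

definition "less_eq_ord_index (k :: 'a ord_index) (l :: 'a ord_index) \<longleftrightarrow> Rep_ord_index k \<le> Rep_ord_index l"

definition "less_ord_index (k :: 'a ord_index) (l :: 'a ord_index) \<longleftrightarrow> Rep_ord_index k < Rep_ord_index l"

instance
proof
  show "finite (UNIV :: 'a ord_index set)"
    by (metis finite_imageI finite_lessThan type_definition.Abs_image type_definition_ord_index)
  show "P a" if "\<And>x. (\<And>y. y < x \<Longrightarrow> P y) \<Longrightarrow> P x" for P and a :: "'a ord_index"
    using that unfolding less_ord_index_def by (rule measure_induct_rule)
qed (auto simp: less_eq_ord_index_def less_ord_index_def Rep_ord_index_inject)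

end

lemma card_ord_index: "CARD('n ord_index) = CARD('n::finite)"
proof -
  have "CARD('n ord_index) = card (range (Rep_ord_index :: 'n ord_index \<Rightarrow> nat))"
    by (simp add: card_image inj_on_def Rep_ord_index_inject)
  also have "range (Rep_ord_index :: 'n ord_index \<Rightarrow> nat) = {..<CARD('n)}"
    by (rule type_definition.Rep_range[OF type_definition_ord_index])
  finally show ?thesis
    by simp
qed

lemma matrix_vector_mult_vec_reindex:
  fixes A :: "real^'n^'n" and \<sigma> :: "'k::finite \<Rightarrow> 'n"
  assumes \<sigma>: "bij \<sigma>"
  shows "(\<chi> k l. A $ \<sigma> k $ \<sigma> l) *v (\<chi> k. x $ \<sigma> k) = (\<chi> k. (A *v x) $ \<sigma> k)"
proof -
  have "(\<Sum>j\<in>UNIV. A $ \<sigma> k $ \<sigma> j * x $ \<sigma> j) = (\<Sum>j\<in>UNIV. A $ \<sigma> k $ j * x $ j)" for k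
    using sum.reindex_bij_betw[OF \<sigma>, of "\<lambda>j. A $ \<sigma> k $ j * x $ j"] by simp
  then show ?thesis
    unfolding vec_eq_iff matrix_vector_mult_def by simp
qed

lemma det_vec_reindex_nz:
  fixes A :: "real^'n^'n" and \<sigma> :: "'k::finite \<Rightarrow> 'n"
  assumes \<sigma>: "bij \<sigma>" and dA: "det A \<noteq> 0"
  shows "det (\<chi> k l. A $ \<sigma> k $ \<sigma> l) \<noteq> 0"
proof -
  let ?B = "\<chi> k l. A $ \<sigma> k $ \<sigma> l"
  have kernel: "y = 0" if "?B *v y = 0" for y
  proof -
    let ?x = "\<chi> n. y $ inv \<sigma> n"
    have y: "y = (\<chi> k. ?x $ \<sigma> k)"
      using \<sigma> by (simp add: vec_eq_iff bij_is_inj)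
    have "(\<chi> k. (A *v ?x) $ \<sigma> k) = 0"
      using that matrix_vector_mult_vec_reindex[OF \<sigma>, of A ?x] \<sigma> by (simp add: bij_is_inj)
    then have "(A *v ?x) $ \<sigma> (inv \<sigma> n) = 0" for n
      by (simp add: vec_eq_iff)
    then have "A *v ?x = A *v 0"
      using \<sigma> by (simp add: vec_eq_iff bij_is_surj surj_f_inv_f)
    moreover have "inj ((*v) A)"
      using dA det_nz_iff_inj[OF matrix_vector_mul_linear[of A]] by simp
    ultimately have "?x = 0"
      by (simp add: injD)
    then show ?thesis
      by (subst y) (simp add: vec_eq_iff)
  qed
  have "inj ((*v) ?B)"
  proof (rule injI)
    fix y1 y2 assume "?B *v y1 = ?B *v y2"
    then have "?B *v (y1 - y2) = 0"
      by (simp add: matrix_vector_mult_diff_distrib)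
    then show "y1 = y2"
      using kernel[of "y1 - y2"] by simp
  qed
  then show ?thesis
    using det_nz_iff_inj[OF matrix_vector_mul_linear[of ?B]] by simp
qed

text \<open>The constant below is \<open>\<bar>det A\<bar>\<close>, but only its positivity is used, which spares
  relating determinants across the relabelling.\<close>

lemma nn_integral_lborel_matrix:
  fixes A :: "real^'n^'n"
  assumes dA: "det A \<noteq> 0"
  obtains c :: real where "0 < c"
    and "\<And>h. h \<in> borel_measurable borel \<Longrightarrow>
      (\<integral>\<^sup>+x. h x \<partial>lborel) = ennreal c * (\<integral>\<^sup>+x. h (A *v x) \<partial>lborel)"
proof -
  obtain \<sigma> :: "'n ord_index \<Rightarrow> 'n" where \<sigma>: "bij \<sigma>"
    using finite_same_card_bij[of "UNIV :: 'n ord_index set" "UNIV :: 'n set"] card_ord_index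
    by auto
  define P :: "real^'n \<Rightarrow> real^'n ord_index" where "P x = (\<chi> k. x $ \<sigma> k)" for x
  define Q :: "real^'n ord_index \<Rightarrow> real^'n" where "Q y = (\<chi> n. y $ inv \<sigma> n)" for y
  define B where "B = (\<chi> k l. A $ \<sigma> k $ \<sigma> l)"
  have [measurable]: "Q \<in> borel_measurable borel"
    unfolding Q_def[abs_def] by (rule vec_reindex_measurable)
  have PQ: "P (Q y) = y" and QP: "Q (P x) = x" for x y
    using \<sigma> by (simp_all add: P_def Q_def vec_eq_iff bij_is_inj bij_is_surj surj_f_inv_f)
  have QB: "Q (B *v y) = A *v Q y" for y
    using matrix_vector_mult_vec_reindex[OF \<sigma>, of A "Q y", folded B_def P_def] by (simp add: PQ QP)
  have "det B \<noteq> 0"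
    unfolding B_def using \<sigma> dA by (rule det_vec_reindex_nz)
  have reindex: "(\<integral>\<^sup>+y. g (Q y) \<partial>lborel) = (\<integral>\<^sup>+x. g x \<partial>lborel)"
    if [measurable]: "g \<in> borel_measurable borel" for g :: "real^'n \<Rightarrow> ennreal"
    using nn_integral_distr[of Q lborel borel g] lborel_distr_vec_reindex[of "inv \<sigma>"] \<sigma>
    by (simp add: bij_imp_bij_inv Q_def[abs_def])
  show ?thesis
  proof
    show "0 < \<bar>det B\<bar>"
      using \<open>det B \<noteq> 0\<close> by simp
    fix h :: "real^'n \<Rightarrow> ennreal" assume [measurable]: "h \<in> borel_measurable borel"
    have "(\<integral>\<^sup>+x. h x \<partial>lborel) = (\<integral>\<^sup>+y. h (Q y) \<partial>lborel)"
      by (simp add: reindex)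
    also have "\<dots> = ennreal \<bar>det B\<bar> * (\<integral>\<^sup>+y. h (Q (B *v y)) \<partial>lborel)"
      by (subst lborel_eq_density_distr_matrix_wellorder[OF \<open>det B \<noteq> 0\<close>])
         (simp add: nn_integral_density nn_integral_distr nn_integral_cmult)
    also have "(\<lambda>y. Q (B *v y)) = (\<lambda>y. A *v Q y)"
      by (simp add: QB)
    also have "(\<integral>\<^sup>+y. h (A *v Q y) \<partial>lborel) = (\<integral>\<^sup>+x. h (A *v x) \<partial>lborel)"
      by (rule reindex) measurable
    finally show "(\<integral>\<^sup>+x. h x \<partial>lborel) = ennreal \<bar>det B\<bar> * (\<integral>\<^sup>+x. h (A *v x) \<partial>lborel)" .
  qed
qed

lemma nn_integral_lborel_translate:
  fixes t :: "'a::euclidean_space"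
  assumes [measurable]: "f \<in> borel_measurable borel"
  shows "(\<integral>\<^sup>+x. f (x + t) \<partial>lborel) = (\<integral>\<^sup>+x. f x \<partial>lborel)"
  using nn_integral_distr[of "(+) t" lborel borel f] by (simp add: lborel_distr_plus add.commute)

section \<open>Gaussian mixtures of Gaussian probabilities\<close>

lemma matrix_sum_squares_mult_vec:
  fixes S S' R :: "real^'n^'n"
  assumes "S ** S = S' ** S' + R ** R"
  shows "S *v (S *v u) = S' *v (S' *v u) + R *v (R *v u)"
  using assms by (simp add: matrix_vector_mul_assoc matrix_vector_mult_add_rdistrib)

lemma matrix_sum_squares_inner:
  fixes S S' R :: "real^'n^'n"
  assumes "sym_mat S" "sym_mat S'" "sym_mat R" and "S ** S = S' ** S' + R ** R"
  shows "(S *v u) \<bullet> (S *v u) = (S' *v u) \<bullet> (S' *v u) + (R *v u) \<bullet> (R *v u)"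
proof -
  have "(S *v u) \<bullet> (S *v u) = u \<bullet> (S *v (S *v u))"
    using sym_mat_inner_mult[OF assms(1), of u "S *v u"] by simp
  also have "\<dots> = u \<bullet> (S' *v (S' *v u)) + u \<bullet> (R *v (R *v u))"
    by (simp add: matrix_sum_squares_mult_vec[OF assms(4)] inner_add_right)
  also have "\<dots> = (S' *v u) \<bullet> (S' *v u) + (R *v u) \<bullet> (R *v u)"
    using sym_mat_inner_mult[OF assms(2), of u "S' *v u"] sym_mat_inner_mult[OF assms(3), of u "R *v u"]
    by simp
  finally show ?thesis .
qed

text \<open>Completing the square in \<open>z\<close>: the exponent of the joint density of \<open>(S' \<eta> + R z, z)\<close>
  at \<open>(w, z)\<close> splits into the exponent of the density of \<open>S \<eta>\<close> at \<open>w\<close> and a quadratic form in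
  \<open>z\<close> centred at \<open>R S\<^sup>-\<^sup>2 w\<close>.\<close>

lemma gauss_exponent_complete_square:
  fixes S S' R :: "real^'n^'n" and w z :: "real^'n"
  assumes sS: "sym_mat S" and sS': "sym_mat S'" and sR: "sym_mat R"
    and dS: "det S \<noteq> 0" and dS': "det S' \<noteq> 0"
    and eq: "S ** S = S' ** S' + R ** R"
  defines "y \<equiv> z - R *v (matrix_inv S *v (matrix_inv S *v w))"
  shows "(norm (matrix_inv S' *v (w - R *v z)))\<^sup>2 + (norm z)\<^sup>2
       = ((norm y)\<^sup>2 + (norm (matrix_inv S' *v (R *v y)))\<^sup>2) + (norm (matrix_inv S *v w))\<^sup>2"
proof -
  let ?Si = "matrix_inv S" and ?Ti = "matrix_inv S'"
  define u where "u = ?Si *v (?Si *v w)"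
  have w: "w = S' *v (S' *v u) + R *v (R *v u)"
    by (simp add: u_def matrix_inv_mult_vec_cancel(2)[OF dS] flip: matrix_sum_squares_mult_vec[OF eq])
  have z: "z = y + R *v u"
    by (simp add: y_def u_def)
  have A: "?Ti *v (w - R *v z) = S' *v u - ?Ti *v (R *v y)"
  proof -
    have "w - R *v z = S' *v (S' *v u) - R *v y"
      using w z by (simp add: matrix_vector_right_distrib algebra_simps)
    then show ?thesis
      by (simp add: matrix_vector_mult_diff_distrib matrix_inv_mult_vec_cancel(1)[OF dS'])
  qed
  have Siw: "?Si *v w = S *v u"
    by (simp add: u_def matrix_inv_mult_vec_cancel(1,2)[OF dS])
  have i1: "(S' *v u) \<bullet> (?Ti *v (R *v y)) = u \<bullet> (R *v y)"
    using sym_mat_inner_mult[OF sS', of u "?Ti *v (R *v y)"]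
    by (simp add: matrix_inv_mult_vec_cancel(2)[OF dS'])
  have i2: "y \<bullet> (R *v u) = u \<bullet> (R *v y)"
    using sym_mat_inner_mult[OF sR, of y u] sym_mat_inner_mult[OF sR, of u y] by (simp add: inner_commute)
  show ?thesis
    unfolding A Siw power2_norm_eq_inner
    using i1 i2 matrix_sum_squares_inner[OF sS sS' sR eq, of u] z
    by (simp add: inner_diff_left inner_diff_right inner_add_left inner_add_right inner_commute algebra_simps)
qed

definition ephi :: "(real^'n) set \<Rightarrow> real^'n \<Rightarrow> real^'n^'n \<Rightarrow> ennreal" where
  "ephi A x S = (\<integral>\<^sup>+\<eta>. ennreal (gauss_density \<eta>) * indicator A (x + S *v \<eta>) \<partial>lborel)"

lemma phi_eq_enn2real_ephi:
  fixes A :: "(real^'n) set"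
  assumes [measurable]: "A \<in> sets borel"
  shows "phi A x S = enn2real (ephi A x S)"
proof -
  have "{\<eta>. x + S *v \<eta> \<in> A} \<in> sets borel"
    by measurable
  then have "emeasure std_gauss {\<eta>. x + S *v \<eta> \<in> A} = ephi A x S"
    unfolding std_gauss_density ephi_def
    by (subst emeasure_density) (auto intro!: nn_integral_cong simp: indicator_def)
  then show ?thesis
    by (simp add: phi_def measure_def)
qed

lemma ephi_le_1: "ephi (A::(real^'n) set) x S \<le> 1"
proof -
  have "ephi A x S \<le> (\<integral>\<^sup>+\<eta>. ennreal (gauss_density (\<eta>::real^'n)) \<partial>lborel)"
    unfolding ephi_def by (rule nn_integral_mono) (simp add: indicator_def)
  then show ?thesis
    by (simp add: nn_integral_gauss_density)
qed

lemma ephi_UNIV: "ephi UNIV x S = 1"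
  by (simp add: ephi_def nn_integral_gauss_density)

lemma eq_ennreal_divide_mult: "d > 0 \<Longrightarrow> X = ennreal d * Y \<Longrightarrow> Y = ennreal (1 / d) * X"
  by (simp add: mult.assoc[symmetric] ennreal_mult[symmetric])

lemma ephi_density:
  fixes S :: "real^'n^'n"
  assumes dS: "det S \<noteq> 0"
  obtains c :: real where "0 < c"
    and "\<And>A x. A \<in> sets borel \<Longrightarrow>
      ephi A x S = ennreal c * (\<integral>\<^sup>+w. ennreal (gauss_density (matrix_inv S *v (w - x))) * indicator A w \<partial>lborel)"
proof -
  obtain c where c: "0 < c"
    "\<And>h. h \<in> borel_measurable borel \<Longrightarrow> (\<integral>\<^sup>+x. h x \<partial>lborel) = ennreal c * (\<integral>\<^sup>+x. h (S *v x) \<partial>lborel)"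
    using nn_integral_lborel_matrix[OF dS] by blast
  show ?thesis
  proof (rule that[of "1 / c"])
    fix A :: "(real^'n) set" and x assume [measurable]: "A \<in> sets borel"
    have "(\<integral>\<^sup>+w. ennreal (gauss_density (matrix_inv S *v (w - x))) * indicator A w \<partial>lborel)
        = (\<integral>\<^sup>+u. ennreal (gauss_density (matrix_inv S *v u)) * indicator A (x + u) \<partial>lborel)"
      using nn_integral_lborel_translate[of "\<lambda>u. ennreal (gauss_density (matrix_inv S *v u)) * indicator A (x + u)" "- x"]
      by simp
    also have "\<dots> = ennreal c * ephi A x S"
      unfolding ephi_def by (subst c(2)) (simp_all add: matrix_inv_mult_vec_cancel(1)[OF dS])
    finally show "ephi A x S = ennreal (1 / c)
        * (\<integral>\<^sup>+w. ennreal (gauss_density (matrix_inv S *v (w - x))) * indicator A w \<partial>lborel)"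
      using c(1) by (intro eq_ennreal_divide_mult) simp_all
  qed (use c(1) in simp)
qed

lemma gauss_density_convolution:
  fixes S S' R :: "real^'n^'n"
  assumes sS: "sym_mat S" and sS': "sym_mat S'" and sR: "sym_mat R"
    and dS: "det S \<noteq> 0" and dS': "det S' \<noteq> 0"
    and eq: "S ** S = S' ** S' + R ** R"
  defines "K \<equiv> (\<integral>\<^sup>+y. ennreal ((2 * pi) powr (- real CARD('n) / 2) *
              exp (- ((norm y)\<^sup>2 + (norm (matrix_inv S' *v (R *v y)))\<^sup>2) / 2)) \<partial>lborel)"
  shows "(\<integral>\<^sup>+z. ennreal (gauss_density (matrix_inv S' *v (w - R *v z)) * gauss_density z) \<partial>lborel)
       = K * ennreal (gauss_density (matrix_inv S *v w))"
proof -
  let ?c = "(2 * pi) powr (- real CARD('n) / 2)"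
  define m where "m = R *v (matrix_inv S *v (matrix_inv S *v w))"
  define h where "h y = ?c * exp (- ((norm y)\<^sup>2 + (norm (matrix_inv S' *v (R *v y)))\<^sup>2) / 2)" for y :: "real^'n"
  have [measurable]: "h \<in> borel_measurable borel"
    unfolding h_def by measurable
  have pt: "gauss_density (matrix_inv S' *v (w - R *v z)) * gauss_density z = h (z - m) * gauss_density (matrix_inv S *v w)" for z
  proof -
    have cs: "(norm (matrix_inv S' *v (w - R *v z)))\<^sup>2 + (norm z)\<^sup>2
       = ((norm (z - m))\<^sup>2 + (norm (matrix_inv S' *v (R *v (z - m))))\<^sup>2) + (norm (matrix_inv S *v w))\<^sup>2"
      unfolding m_def by (rule gauss_exponent_complete_square[OF sS sS' sR dS dS' eq])
    have "gauss_density (matrix_inv S' *v (w - R *v z)) * gauss_density z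
        = ?c * ?c * exp (- ((norm (matrix_inv S' *v (w - R *v z)))\<^sup>2 + (norm z)\<^sup>2) / 2)"
      by (simp add: gauss_density_def exp_add[symmetric] add_divide_distrib)
    also have "\<dots> = ?c * ?c * exp (- ((norm (z - m))\<^sup>2 + (norm (matrix_inv S' *v (R *v (z - m))))\<^sup>2) / 2
                  + - (norm (matrix_inv S *v w))\<^sup>2 / 2)"
      by (simp only: cs) (simp add: add_divide_distrib)
    also have "\<dots> = (?c * exp (- ((norm (z - m))\<^sup>2 + (norm (matrix_inv S' *v (R *v (z - m))))\<^sup>2) / 2))
                   * (?c * exp (- (norm (matrix_inv S *v w))\<^sup>2 / 2))"
      by (simp only: exp_add mult_ac)
    also have "\<dots> = h (z - m) * gauss_density (matrix_inv S *v w)"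
      by (simp only: h_def gauss_density_def)
    finally show ?thesis .
  qed
  have "(\<integral>\<^sup>+z. ennreal (gauss_density (matrix_inv S' *v (w - R *v z)) * gauss_density z) \<partial>lborel)
      = (\<integral>\<^sup>+z. ennreal (h (z - m)) * ennreal (gauss_density (matrix_inv S *v w)) \<partial>lborel)"
    by (intro nn_integral_cong) (simp add: pt ennreal_mult' h_def)
  also have "\<dots> = (\<integral>\<^sup>+z. ennreal (h (z + - m)) \<partial>lborel) * ennreal (gauss_density (matrix_inv S *v w))"
    by (simp add: nn_integral_multc)
  also have "(\<integral>\<^sup>+z. ennreal (h (z + - m)) \<partial>lborel) = K"
    unfolding K_def h_def[symmetric] by (rule nn_integral_lborel_translate) measurable
  finally show ?thesis .
qed

lemma ephi_gauss_mixture_proportional: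
  fixes S S' R :: "real^'n^'n"
  assumes sS: "sym_mat S" and sS': "sym_mat S'" and sR: "sym_mat R"
    and dS: "det S \<noteq> 0" and dS': "det S' \<noteq> 0"
    and eq: "S ** S = S' ** S' + R ** R"
  obtains \<kappa> where "\<And>A y. A \<in> sets borel \<Longrightarrow>
    (\<integral>\<^sup>+\<xi>. ennreal (gauss_density \<xi>) * ephi A (y + R *v \<xi>) S' \<partial>lborel) = \<kappa> * ephi A y S"
proof -
  let ?Si = "matrix_inv S" and ?Ti = "matrix_inv S'"
  obtain c where c: "0 < c" "\<And>A x. A \<in> sets borel \<Longrightarrow> ephi A x S
      = ennreal c * (\<integral>\<^sup>+w. ennreal (gauss_density (?Si *v (w - x))) * indicator A w \<partial>lborel)"
    using ephi_density[OF dS] by blast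
  obtain c' where c': "\<And>A x. A \<in> sets borel \<Longrightarrow> ephi A x S'
      = ennreal c' * (\<integral>\<^sup>+w. ennreal (gauss_density (?Ti *v (w - x))) * indicator A w \<partial>lborel)"
    using ephi_density[OF dS'] by blast
  define K where "K = (\<integral>\<^sup>+y. ennreal ((2 * pi) powr (- real CARD('n) / 2) *
              exp (- ((norm y)\<^sup>2 + (norm (?Ti *v (R *v y)))\<^sup>2) / 2)) \<partial>lborel)"
  have "(\<integral>\<^sup>+\<xi>. ennreal (gauss_density \<xi>) * ephi A (y + R *v \<xi>) S' \<partial>lborel)
      = (ennreal c' * K * ennreal (1 / c)) * ephi A y S"
    if A[measurable]: "A \<in> sets borel" for A y
  proof -
    have "(\<integral>\<^sup>+\<xi>. ennreal (gauss_density \<xi>) * ephi A (y + R *v \<xi>) S' \<partial>lborel)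
        = ennreal c' * (\<integral>\<^sup>+\<xi>. (\<integral>\<^sup>+w. ennreal (gauss_density \<xi>) *
            (ennreal (gauss_density (?Ti *v (w - y - R *v \<xi>))) * indicator A w) \<partial>lborel) \<partial>lborel)"
      by (simp add: c'[OF A] nn_integral_cmult[symmetric] mult_ac diff_diff_eq)
    also have "\<dots> = ennreal c' * (\<integral>\<^sup>+w. indicator A w * (\<integral>\<^sup>+\<xi>.
            ennreal (gauss_density (?Ti *v ((w - y) - R *v \<xi>)) * gauss_density \<xi>) \<partial>lborel) \<partial>lborel)"
      by (subst lborel_pair.Fubini')
         (simp_all add: nn_integral_cmult[symmetric] ennreal_mult' mult_ac)
    also have "\<dots> = ennreal c' * (\<integral>\<^sup>+w. K * (ennreal (gauss_density (?Si *v (w - y))) * indicator A w) \<partial>lborel)"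
      using gauss_density_convolution[OF sS sS' sR dS dS' eq, of "_ - y"]
      by (simp add: K_def diff_diff_eq mult_ac)
    also have "\<dots> = ennreal c' * K * (\<integral>\<^sup>+w. ennreal (gauss_density (?Si *v (w - y))) * indicator A w \<partial>lborel)"
      by (subst nn_integral_cmult) (simp_all add: mult.assoc)
    also have "\<dots> = (ennreal c' * K * ennreal (1 / c)) * ephi A y S"
    proof -
      have "ennreal (1 / c) * (ennreal c * X) = X" for X
        using c(1) by (simp add: mult.assoc[symmetric] flip: ennreal_mult)
      then show ?thesis
        by (simp add: c(2)[OF A] mult.assoc)
    qed
    finally show ?thesis .
  qed
  then show ?thesis
    using that by blast
qed

lemma ephi_gauss_mixture:
  fixes S S' R :: "real^'n^'n" and A :: "(real^'n) set"
  assumes "sym_mat S" "sym_mat S'" "sym_mat R" "det S \<noteq> 0" "det S' \<noteq> 0"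
    and "S ** S = S' ** S' + R ** R" and "A \<in> sets borel"
  shows "(\<integral>\<^sup>+\<xi>. ennreal (gauss_density \<xi>) * ephi A (x + R *v \<xi>) S' \<partial>lborel) = ephi A x S"
proof -
  obtain \<kappa> where \<kappa>: "\<And>A y. A \<in> sets borel \<Longrightarrow>
      (\<integral>\<^sup>+\<xi>. ennreal (gauss_density \<xi>) * ephi A (y + R *v \<xi>) S' \<partial>lborel) = \<kappa> * ephi A y S"
    using ephi_gauss_mixture_proportional assms(1-6) by blast
  \<comment> \<open>The constant is never computed: the case A = UNIV shows that it is 1.\<close>
  have "\<kappa> = 1"
    using \<kappa>[of UNIV x] by (simp add: ephi_UNIV nn_integral_gauss_density)
  then show ?thesis
    using \<kappa>[OF assms(7)] by simp
qed

lemma ephi_measurable[measurable]: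
  fixes A :: "(real^'n) set"
  assumes [measurable]: "A \<in> sets borel"
  shows "(\<lambda>y. ephi A y S) \<in> borel_measurable borel"
  unfolding ephi_def by measurable

lemma ephi_neq_top: "ephi (A::(real^'n) set) x S \<noteq> top"
  using ephi_le_1[of A x S] by (metis ennreal_one_neq_top neq_top_trans)

lemma ennreal_enn2real_ephi: "ennreal (enn2real (ephi (A::(real^'n) set) x S)) = ephi A x S"
  by (rule ennreal_enn2real) (simp add: ephi_neq_top less_top[symmetric])

lemma phi_measurable[measurable]:
  fixes A :: "(real^'n) set"
  assumes [measurable]: "A \<in> sets borel"
  shows "(\<lambda>y. phi A y S) \<in> borel_measurable borel"
  by (simp add: phi_eq_enn2real_ephi)

lemma phi_nonneg_le_1: "0 \<le> phi A x S" "phi A x S \<le> 1"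
  by (auto simp: phi_def prob_space.prob_le_1[OF prob_space_std_gauss])

definition gauss_mixture :: "real^'n^'n \<Rightarrow> (real^'n \<Rightarrow> real) \<Rightarrow> real^'n \<Rightarrow> real" where
  "gauss_mixture R F y = (\<integral>\<xi>. F (y + R *v \<xi>) \<partial>std_gauss)"

lemma phi_gauss_mixture:
  fixes S S' R :: "real^'n^'n" and A :: "(real^'n) set"
  assumes sS: "sym_mat S" and sS': "sym_mat S'" and sR: "sym_mat R"
    and dS: "det S \<noteq> 0" and dS': "det S' \<noteq> 0"
    and eq: "S ** S = S' ** S' + R ** R" and A[measurable]: "A \<in> sets borel"
  shows "(\<lambda>y. phi A y S) = gauss_mixture R (\<lambda>y. phi A y S')"
proof -
  interpret prob_space "std_gauss :: (real^'n) measure"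
    by (rule prob_space_std_gauss)
  have "phi A x S = (\<integral>\<xi>. phi A (x + R *v \<xi>) S' \<partial>std_gauss)" for x
  proof -
    have meas: "(\<lambda>\<xi>. phi A (x + R *v \<xi>) S') \<in> borel_measurable std_gauss"
      by simp
    have int: "integrable std_gauss (\<lambda>\<xi>. phi A (x + R *v \<xi>) S')"
    proof (rule integrable_const_bound[where B=1])
      show "AE \<xi> in std_gauss. norm (phi A (x + R *v \<xi>) S') \<le> 1"
        by (intro AE_I2) (simp add: abs_of_nonneg[OF phi_nonneg_le_1(1)] phi_nonneg_le_1(2))
    qed (rule meas)
    have "(\<integral>\<^sup>+\<xi>. ennreal (phi A (x + R *v \<xi>) S') \<partial>std_gauss)
        = (\<integral>\<^sup>+\<xi>. ennreal (gauss_density \<xi>) * ephi A (x + R *v \<xi>) S' \<partial>lborel)"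
      unfolding std_gauss_density
      by (subst nn_integral_density) (auto simp: phi_eq_enn2real_ephi ennreal_enn2real_ephi)
    also have "\<dots> = ephi A x S"
      by (rule ephi_gauss_mixture[OF assms])
    finally have ch: "(\<integral>\<^sup>+\<xi>. ennreal (phi A (x + R *v \<xi>) S') \<partial>std_gauss) = ephi A x S" .
    have ae: "AE \<xi> in std_gauss. 0 \<le> phi A (x + R *v \<xi>) S'"
      by (simp add: phi_nonneg_le_1)
    have "ennreal (\<integral>\<xi>. phi A (x + R *v \<xi>) S' \<partial>std_gauss) = ephi A x S"
      using nn_integral_eq_integral[OF int ae] ch by simp
    moreover have nn: "0 \<le> (\<integral>\<xi>. phi A (x + R *v \<xi>) S' \<partial>std_gauss)"
      by (rule integral_nonneg_AE[OF ae])
    ultimately have "enn2real (ephi A x S) = (\<integral>\<xi>. phi A (x + R *v \<xi>) S' \<partial>std_gauss)"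
      by (metis enn2real_ennreal)
    then show ?thesis
      by (simp only: phi_eq_enn2real_ephi[OF A])
  qed
  then show ?thesis
    by (simp add: gauss_mixture_def fun_eq_iff)
qed

section \<open>Differentiation under the integral sign\<close>

lemma difference_quotient_bound:
  fixes F F' :: "real \<Rightarrow> real"
  assumes der: "\<And>t. \<bar>t - t0\<bar> < \<delta> \<Longrightarrow> (F has_real_derivative F' t) (at t)"
    and bd: "\<And>t. \<bar>t - t0\<bar> < \<delta> \<Longrightarrow> \<bar>F' t\<bar> \<le> G"
    and t: "\<bar>t - t0\<bar> < \<delta>" "t \<noteq> t0"
  shows "\<bar>(F t - F t0) / (t - t0)\<bar> \<le> G"
proof (cases "t0 < t")
  case True
  have "\<And>x. t0 \<le> x \<Longrightarrow> x \<le> t \<Longrightarrow> DERIV F x :> F' x"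
    using t True by (intro der) auto
  then obtain z where z: "t0 < z" "z < t" "F t - F t0 = (t - t0) * F' z"
    using MVT2[OF True, of F F'] by blast
  have "\<bar>z - t0\<bar> < \<delta>"
    using z t True by auto
  then show ?thesis
    using z bd True by simp
next
  case False
  then have lt: "t < t0"
    using t by simp
  have "\<And>x. t \<le> x \<Longrightarrow> x \<le> t0 \<Longrightarrow> DERIV F x :> F' x"
    using t lt by (intro der) auto
  then obtain z where z: "t < z" "z < t0" "F t0 - F t = (t0 - t) * F' z"
    using MVT2[OF lt, of F F'] by blast
  have "\<bar>z - t0\<bar> < \<delta>"
    using z t lt by auto
  moreover have "(F t - F t0) / (t - t0) = F' z"
  proof -
    have "F t - F t0 = (t - t0) * F' z"
      using z(3) by (simp add: algebra_simps)
    then show ?thesis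
      using lt by simp
  qed
  ultimately show ?thesis
    using bd by simp
qed

lemma integrable_of_derivative_dominated:
  fixes f f' :: "real \<Rightarrow> 'a \<Rightarrow> real"
  assumes fm: "f t \<in> borel_measurable M"
    and fi: "integrable M (f t0)" and gi: "integrable M g"
    and der: "\<And>\<omega> t. \<omega> \<in> space M \<Longrightarrow> \<bar>t - t0\<bar> < \<delta> \<Longrightarrow> ((\<lambda>s. f s \<omega>) has_real_derivative f' t \<omega>) (at t)"
    and bd: "\<And>\<omega> t. \<omega> \<in> space M \<Longrightarrow> \<bar>t - t0\<bar> < \<delta> \<Longrightarrow> \<bar>f' t \<omega>\<bar> \<le> g \<omega>"
    and t: "\<bar>t - t0\<bar> < \<delta>"
  shows "integrable M (f t)"
proof (cases "t = t0")
  case False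
  have "integrable M (\<lambda>\<omega>. \<bar>f t0 \<omega>\<bar> + \<bar>t - t0\<bar> * g \<omega>)"
    using fi gi by auto
  moreover have "norm (f t \<omega>) \<le> norm (\<bar>f t0 \<omega>\<bar> + \<bar>t - t0\<bar> * g \<omega>)" if \<omega>: "\<omega> \<in> space M" for \<omega>
  proof -
    have "\<bar>(f t \<omega> - f t0 \<omega>) / (t - t0)\<bar> \<le> g \<omega>"
      by (rule difference_quotient_bound[where F'="\<lambda>s. f' s \<omega>"]) (use \<omega> der bd t False in auto)
    then have "\<bar>f t \<omega> - f t0 \<omega>\<bar> \<le> \<bar>t - t0\<bar> * g \<omega>"
      using False by (simp add: abs_divide divide_le_eq mult.commute)
    then show ?thesis
      by simp
  qed
  ultimately show ?thesis
    using fm by (blast intro: Bochner_Integration.integrable_bound AE_I2)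
qed (use fi in simp)

lemma has_real_derivative_integral:
  fixes f f' :: "real \<Rightarrow> 'a \<Rightarrow> real"
  assumes d: "\<delta> > 0"
    and fm: "\<And>t. f t \<in> borel_measurable M"
    and f'm: "f' t0 \<in> borel_measurable M"
    and fi: "integrable M (f t0)"
    and gi: "integrable M g"
    and der: "\<And>\<omega> t. \<omega> \<in> space M \<Longrightarrow> \<bar>t - t0\<bar> < \<delta> \<Longrightarrow> ((\<lambda>s. f s \<omega>) has_real_derivative f' t \<omega>) (at t)"
    and bd: "\<And>\<omega> t. \<omega> \<in> space M \<Longrightarrow> \<bar>t - t0\<bar> < \<delta> \<Longrightarrow> \<bar>f' t \<omega>\<bar> \<le> g \<omega>"
  shows "((\<lambda>t. \<integral>\<omega>. f t \<omega> \<partial>M) has_real_derivative (\<integral>\<omega>. f' t0 \<omega> \<partial>M)) (at t0)"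
proof -
  define q where "q t \<omega> = (f t \<omega> - f t0 \<omega>) / (t - t0)" for t \<omega>
  have qb: "\<bar>q t \<omega>\<bar> \<le> g \<omega>" if "\<omega> \<in> space M" "\<bar>t - t0\<bar> < \<delta>" "t \<noteq> t0" for t \<omega>
    unfolding q_def by (rule difference_quotient_bound[where F'="\<lambda>s. f' s \<omega>"]) (use that der bd in auto)
  have qm: "q t \<in> borel_measurable M" for t
    unfolding q_def using fm by measurable
  have "((\<lambda>t. ((\<integral>\<omega>. f t \<omega> \<partial>M) - (\<integral>\<omega>. f t0 \<omega> \<partial>M)) / (t - t0)) \<longlongrightarrow> (\<integral>\<omega>. f' t0 \<omega> \<partial>M)) (at t0)"
    unfolding tendsto_at_iff_sequentially comp_def
  proof (intro allI impI)
    fix X :: "nat \<Rightarrow> real" assume X: "\<forall>i. X i \<in> UNIV - {t0}" and lim: "X \<longlonglongrightarrow> t0"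
    obtain N where N: "\<And>n. n \<ge> N \<Longrightarrow> \<bar>X n - t0\<bar> < \<delta>"
      using lim d unfolding LIMSEQ_def dist_real_def by blast
    have "((\<integral>\<omega>. f (X (n + N)) \<omega> \<partial>M) - (\<integral>\<omega>. f t0 \<omega> \<partial>M)) / (X (n + N) - t0)
        = (\<integral>\<omega>. q (X (n + N)) \<omega> \<partial>M)" for n
      unfolding q_def using integrable_of_derivative_dominated[OF fm fi gi der bd N[of "n + N"]] fi
      by simp
    moreover have "(\<lambda>n. \<integral>\<omega>. q (X (n + N)) \<omega> \<partial>M) \<longlonglongrightarrow> (\<integral>\<omega>. f' t0 \<omega> \<partial>M)"
    proof (rule integral_dominated_convergence[where w=g])
      show "AE \<omega> in M. (\<lambda>n. q (X (n + N)) \<omega>) \<longlonglongrightarrow> f' t0 \<omega>"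
      proof (rule AE_I2)
        fix \<omega> assume \<omega>: "\<omega> \<in> space M"
        have "((\<lambda>s. (f s \<omega> - f t0 \<omega>) / (s - t0)) \<longlongrightarrow> f' t0 \<omega>) (at t0)"
          using der[OF \<omega>] d by (simp add: has_field_derivative_iff)
        moreover have "(\<lambda>n. X (n + N)) \<longlonglongrightarrow> t0"
          using lim by (rule LIMSEQ_ignore_initial_segment)
        ultimately show "(\<lambda>n. q (X (n + N)) \<omega>) \<longlonglongrightarrow> f' t0 \<omega>"
          using X unfolding q_def tendsto_at_iff_sequentially comp_def by simp
      qed
      show "AE \<omega> in M. norm (q (X (n + N)) \<omega>) \<le> g \<omega>" for n
        by (rule AE_I2) (use qb N X in auto)
    qed (use f'm qm gi in auto)
    ultimately show "(\<lambda>n. ((\<integral>\<omega>. f (X n) \<omega> \<partial>M) - (\<integral>\<omega>. f t0 \<omega> \<partial>M)) / (X n - t0)) \<longlonglongrightarrow> (\<integral>\<omega>. f' t0 \<omega> \<partial>M)"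
      by (simp add: LIMSEQ_offset[where k=N])
  qed
  then show ?thesis
    by (simp add: has_field_derivative_iff)
qed

section \<open>Polynomials times Gaussian weights\<close>

lemma real_polynomial_function_directional_derivative:
  fixes p :: "'a::real_normed_vector \<Rightarrow> real"
  assumes "real_polynomial_function p"
  shows "\<exists>q. real_polynomial_function q \<and>
    (\<forall>u t. ((\<lambda>s. p (u + s *\<^sub>R e)) has_real_derivative q (u + t *\<^sub>R e)) (at t))"
  using assms
proof induction
  case (linear f)
  have "((\<lambda>s. f (u + s *\<^sub>R e)) has_real_derivative f e) (at t)" for u t
  proof -
    have "(\<lambda>s. f (u + s *\<^sub>R e)) = (\<lambda>s. f u + s * f e)"
      using linear by (simp add: linear_add linear_scale bounded_linear.linear)
    then show ?thesis
      by (auto intro!: derivative_eq_intros)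
  qed
  then show ?case
    by blast
next
  case (const c)
  then show ?case
    by (intro exI[of _ "\<lambda>_. 0"]) auto
next
  case (add f g)
  then obtain f' g' where "real_polynomial_function f'" "real_polynomial_function g'"
    "\<And>u t. ((\<lambda>s. f (u + s *\<^sub>R e)) has_real_derivative f' (u + t *\<^sub>R e)) (at t)"
    "\<And>u t. ((\<lambda>s. g (u + s *\<^sub>R e)) has_real_derivative g' (u + t *\<^sub>R e)) (at t)"
    by blast
  then show ?case
    by (intro exI[of _ "\<lambda>v. f' v + g' v"]) (auto intro: DERIV_add)
next
  case (mult f g)
  then obtain f' g' where "real_polynomial_function f'" "real_polynomial_function g'"
    "\<And>u t. ((\<lambda>s. f (u + s *\<^sub>R e)) has_real_derivative f' (u + t *\<^sub>R e)) (at t)"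
    "\<And>u t. ((\<lambda>s. g (u + s *\<^sub>R e)) has_real_derivative g' (u + t *\<^sub>R e)) (at t)"
    by blast
  with mult.hyps show ?case
    by (intro exI[of _ "\<lambda>v. f' v * g v + g' v * f v"]) (auto intro: DERIV_mult)
qed

definition exp_bounded :: "('a::real_normed_vector \<Rightarrow> real) \<Rightarrow> bool" where
  "exp_bounded f \<longleftrightarrow> (\<exists>C D. 0 \<le> C \<and> 0 \<le> D \<and> (\<forall>u. \<bar>f u\<bar> \<le> C * exp (D * norm u)))"

lemma exp_bounded_add:
  assumes "exp_bounded f" "exp_bounded g"
  shows "exp_bounded (\<lambda>u. f u + g u)"
proof -
  obtain C1 D1 C2 D2 where h: "0 \<le> C1" "0 \<le> D1" "\<And>u. \<bar>f u\<bar> \<le> C1 * exp (D1 * norm u)"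
    "0 \<le> C2" "0 \<le> D2" "\<And>u. \<bar>g u\<bar> \<le> C2 * exp (D2 * norm u)"
    using assms unfolding exp_bounded_def by blast
  have "\<bar>f u + g u\<bar> \<le> (C1 + C2) * exp ((D1 + D2) * norm u)" for u
  proof -
    have "exp (D1 * norm u) \<le> exp ((D1 + D2) * norm u)" "exp (D2 * norm u) \<le> exp ((D1 + D2) * norm u)"
      using h by (auto intro!: mult_right_mono)
    then show ?thesis
      using h(1,4) h(3,6)[of u] by (smt (verit) distrib_right mult_left_mono)
  qed
  then show ?thesis
    unfolding exp_bounded_def using h by (intro exI[of _ "C1 + C2"] exI[of _ "D1 + D2"]) auto
qed

lemma exp_bounded_mult:
  assumes "exp_bounded f" "exp_bounded g"
  shows "exp_bounded (\<lambda>u. f u * g u)"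
proof -
  obtain C1 D1 C2 D2 where h: "0 \<le> C1" "0 \<le> D1" "\<And>u. \<bar>f u\<bar> \<le> C1 * exp (D1 * norm u)"
    "0 \<le> C2" "0 \<le> D2" "\<And>u. \<bar>g u\<bar> \<le> C2 * exp (D2 * norm u)"
    using assms unfolding exp_bounded_def by blast
  have "\<bar>f u * g u\<bar> \<le> (C1 * C2) * exp ((D1 + D2) * norm u)" for u
  proof -
    have "\<bar>f u * g u\<bar> \<le> (C1 * exp (D1 * norm u)) * (C2 * exp (D2 * norm u))"
      unfolding abs_mult using h by (intro mult_mono) auto
    also have "\<dots> = (C1 * C2) * exp ((D1 + D2) * norm u)"
      by (simp add: distrib_right exp_add[symmetric] algebra_simps)
    finally show ?thesis .
  qed
  then show ?thesis
    unfolding exp_bounded_def using h by (intro exI[of _ "C1 * C2"] exI[of _ "D1 + D2"]) auto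
qed

lemma real_polynomial_function_exp_bounded:
  assumes "real_polynomial_function p"
  shows "exp_bounded p"
  using assms
proof induction
  case (linear f)
  then obtain K where K: "0 < K" "\<And>u. norm (f u) \<le> norm u * K"
    using bounded_linear.pos_bounded by blast
  have "\<bar>f u\<bar> \<le> K * exp (1 * norm u)" for u
  proof -
    have "\<bar>f u\<bar> \<le> K * norm u"
      using K(2)[of u] by (simp add: mult.commute)
    also have "\<dots> \<le> K * exp (norm u)"
      using K(1) by (intro mult_left_mono) (auto intro: order_trans[OF _ exp_ge_add_one_self])
    finally show ?thesis
      by simp
  qed
  then show ?case
    unfolding exp_bounded_def using K(1) by (intro exI[of _ K] exI[of _ 1]) auto
next
  case (const c)
  then show ?case
    unfolding exp_bounded_def by (intro exI[of _ "\<bar>c\<bar>"] exI[of _ 0]) simp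
qed (simp_all add: exp_bounded_add exp_bounded_mult)

lemma real_polynomial_function_measurable:
  fixes p :: "'a::euclidean_space \<Rightarrow> real"
  assumes "real_polynomial_function p"
  shows "p \<in> borel_measurable borel"
  using assms by (intro borel_measurable_continuous_onI continuous_on_polymonial_function)
     (simp add: real_polynomial_function_eq)

definition gauss_weight :: "real^'n^'n \<Rightarrow> real^'n \<Rightarrow> real" where
  "gauss_weight N v = exp (- (norm (N *v v))\<^sup>2 / 2)"

lemma gauss_weight_pos: "0 < gauss_weight N v"
  by (simp add: gauss_weight_def)

lemma gauss_weight_measurable[measurable]: "gauss_weight N \<in> borel_measurable borel"
  unfolding gauss_weight_def by measurable

lemma gauss_weight_directional_derivative:
  "((\<lambda>s. gauss_weight N (u + s *\<^sub>R e)) has_real_derivative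
      gauss_weight N (u + t *\<^sub>R e) * (- ((N *v (u + t *\<^sub>R e)) \<bullet> (N *v e)))) (at t)"
proof -
  define a where "a = N *v u"
  define b where "b = N *v e"
  have eq: "(norm (N *v (u + s *\<^sub>R e)))\<^sup>2 = a \<bullet> a + 2 * s * (a \<bullet> b) + s\<^sup>2 * (b \<bullet> b)" for s
  proof -
    have "N *v (u + s *\<^sub>R e) = a + s *\<^sub>R b"
      by (simp add: a_def b_def matrix_vector_right_distrib matrix_vector_mult_scaleR)
    then show ?thesis
      unfolding power2_norm_eq_inner
      by (simp add: inner_add_left inner_add_right inner_commute[of b a] power2_eq_square algebra_simps)
  qed
  have "((\<lambda>s. exp (- (a \<bullet> a + 2 * s * (a \<bullet> b) + s\<^sup>2 * (b \<bullet> b)) / 2)) has_real_derivative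
      exp (- (a \<bullet> a + 2 * t * (a \<bullet> b) + t\<^sup>2 * (b \<bullet> b)) / 2) * (- (a \<bullet> b + t * (b \<bullet> b)))) (at t)"
    by (auto intro!: derivative_eq_intros simp: power2_eq_square field_simps)
  moreover have "(N *v (u + t *\<^sub>R e)) \<bullet> (N *v e) = a \<bullet> b + t * (b \<bullet> b)"
    by (simp add: a_def b_def matrix_vector_right_distrib matrix_vector_mult_scaleR inner_add_left)
  ultimately show ?thesis
    by (simp add: gauss_weight_def eq)
qed

lemma gauss_weight_le:
  fixes N :: "real^'n^'n"
  assumes dN: "det N \<noteq> 0"
  obtains k where "0 < k" "\<And>v. gauss_weight N v \<le> exp (- k * (norm v)\<^sup>2)"
proof -
  obtain B where B: "B > 0" "\<And>x. norm (matrix_inv N *v x) \<le> B * norm x"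
    using linear_bounded_pos[OF matrix_vector_mul_linear[of "matrix_inv N"]] by blast
  have "norm v \<le> B * norm (N *v v)" for v
    using B(2)[of "N *v v"] by (simp add: matrix_inv_mult_vec_cancel(1)[OF dN])
  then have nv: "(norm v)\<^sup>2 / B\<^sup>2 \<le> (norm (N *v v))\<^sup>2" for v
    using B(1) by (simp add: divide_le_eq power_mult_distrib[symmetric] power_mono mult.commute)
  show ?thesis
  proof
    show "0 < 1 / (2 * B\<^sup>2)"
      using B by simp
    fix v
    have "- (norm (N *v v))\<^sup>2 / 2 \<le> - (1 / (2 * B\<^sup>2)) * (norm v)\<^sup>2"
      using nv[of v] by (simp add: field_simps)
    then show "gauss_weight N v \<le> exp (- (1 / (2 * B\<^sup>2)) * (norm v)\<^sup>2)"
      by (simp add: gauss_weight_def)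
  qed
qed

lemma gauss_weighted_polynomial_directional_derivative:
  fixes p :: "real^'n \<Rightarrow> real"
  assumes "real_polynomial_function p"
  obtains q where "real_polynomial_function q"
    and "\<And>u t. ((\<lambda>s. p (u + s *\<^sub>R e) * gauss_weight N (u + s *\<^sub>R e)) has_real_derivative
        q (u + t *\<^sub>R e) * gauss_weight N (u + t *\<^sub>R e)) (at t)"
proof -
  obtain p' where p': "real_polynomial_function p'"
    "\<And>u t. ((\<lambda>s. p (u + s *\<^sub>R e)) has_real_derivative p' (u + t *\<^sub>R e)) (at t)"
    using real_polynomial_function_directional_derivative[OF assms] by blast
  let ?w = "transpose N *v (N *v e)"
  have inner_w: "(N *v v) \<bullet> (N *v e) = v \<bullet> ?w" for v
    by (simp add: dot_lmul_matrix[symmetric] inner_commute)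
  show ?thesis
  proof
    have "real_polynomial_function (\<lambda>v. v \<bullet> ?w)"
      by (intro real_polynomial_function.intros(1) bounded_linear_inner_left)
    with assms have "real_polynomial_function (\<lambda>v. p v * (v \<bullet> ?w))"
      by (rule real_polynomial_function.intros(4))
    with p'(1) show "real_polynomial_function (\<lambda>v. p' v - p v * (v \<bullet> ?w))"
      by (rule real_polynomial_function_diff)
    show "((\<lambda>s. p (u + s *\<^sub>R e) * gauss_weight N (u + s *\<^sub>R e)) has_real_derivative
        (p' (u + t *\<^sub>R e) - p (u + t *\<^sub>R e) * ((u + t *\<^sub>R e) \<bullet> ?w)) * gauss_weight N (u + t *\<^sub>R e)) (at t)"
      for u t
      by (rule DERIV_cong[OF DERIV_mult[OF p'(2) gauss_weight_directional_derivative]])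
         (simp add: inner_w algebra_simps)
  qed
qed

lemma exp_linear_minus_square_le:
  fixes a b :: real
  assumes k: "0 < k" and D: "0 \<le> D" and ab: "0 \<le> a" "\<bar>a - b\<bar> \<le> r"
  shows "exp (D * a - k * a\<^sup>2) \<le> exp (D * r + k * r\<^sup>2 + D\<^sup>2 / k) * exp (- (k / 4) * b\<^sup>2)"
proof -
  have "D * a \<le> D * b + D * r"
    using D ab by (simp add: distrib_left[symmetric] mult_left_mono)
  moreover have "2 * (k / 4 * b\<^sup>2) - k * r\<^sup>2 \<le> k * a\<^sup>2"
  proof -
    have "\<bar>b\<bar> \<le> \<bar>a + r\<bar>"
      using ab by arith
    then have "b\<^sup>2 \<le> (a + r)\<^sup>2"
      by (simp add: abs_le_square_iff)
    also have "\<dots> \<le> 2 * a\<^sup>2 + 2 * r\<^sup>2"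
      using sum_squares_ge_zero[of "a - r" 0] by (simp add: power2_eq_square algebra_simps)
    finally have "k * (b\<^sup>2 - 2 * r\<^sup>2) \<le> k * (2 * a\<^sup>2)"
      using k by (intro mult_left_mono) auto
    then show ?thesis
      by (simp add: algebra_simps)
  qed
  moreover have "D * b - k / 4 * b\<^sup>2 \<le> D\<^sup>2 / k"
  proof -
    have "0 \<le> k / 4 * (b - 2 * D / k)\<^sup>2"
      using k by simp
    also have "\<dots> = k / 4 * b\<^sup>2 - D * b + D\<^sup>2 / k"
      using k by (simp add: power2_eq_square field_simps)
    finally show ?thesis
      by simp
  qed
  ultimately have "D * a - k * a\<^sup>2 \<le> (D * r + k * r\<^sup>2 + D\<^sup>2 / k) - k / 4 * b\<^sup>2"
    by linarith
  then have "exp (D * a - k * a\<^sup>2) \<le> exp ((D * r + k * r\<^sup>2 + D\<^sup>2 / k) + - (k / 4) * b\<^sup>2)"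
    by simp
  then show ?thesis
    by (simp only: exp_add)
qed

lemma gauss_weighted_polynomial_dominated:
  fixes N :: "real^'n^'n" and p :: "real^'n \<Rightarrow> real"
  assumes dN: "det N \<noteq> 0" and p: "real_polynomial_function p"
  obtains k C where "0 < k"
    and "\<And>v0 v. norm (v - v0) \<le> r \<Longrightarrow> \<bar>p v * gauss_weight N v\<bar> \<le> C * exp (- k * (norm v0)\<^sup>2)"
proof -
  obtain C D where CD: "0 \<le> C" "0 \<le> D" "\<And>u. \<bar>p u\<bar> \<le> C * exp (D * norm u)"
    using real_polynomial_function_exp_bounded[OF p] unfolding exp_bounded_def by blast
  obtain k where k: "0 < k" "\<And>v. gauss_weight N v \<le> exp (- k * (norm v)\<^sup>2)"
    using gauss_weight_le[OF dN] by blast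
  show ?thesis
  proof
    show "0 < k / 4"
      using k by simp
    fix v0 v :: "real^'n" assume vr: "norm (v - v0) \<le> r"
    have "\<bar>p v * gauss_weight N v\<bar> \<le> (C * exp (D * norm v)) * exp (- k * (norm v)\<^sup>2)"
      unfolding abs_mult using CD k gauss_weight_pos[of N v]
      by (intro mult_mono) (auto simp: less_imp_le)
    also have "\<dots> = C * exp (D * norm v - k * (norm v)\<^sup>2)"
      by (simp add: mult.assoc exp_add[symmetric])
    also have "\<dots> \<le> C * (exp (D * r + k * r\<^sup>2 + D\<^sup>2 / k) * exp (- (k / 4) * (norm v0)\<^sup>2))"
      using CD k vr norm_triangle_ineq3[of v v0]
      by (intro mult_left_mono exp_linear_minus_square_le) auto
    finally show "\<bar>p v * gauss_weight N v\<bar> \<le> (C * exp (D * r + k * r\<^sup>2 + D\<^sup>2 / k)) * exp (- (k / 4) * (norm v0)\<^sup>2)"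
      by (simp add: mult.assoc)
  qed
qed

lemma integrable_exp_neg_square_norm:
  assumes c: "0 < c"
  shows "integrable lborel (\<lambda>v::real^'n. exp (- c * (norm v)\<^sup>2))"
proof -
  define s where "s = 1 / sqrt (2 * c)"
  have s: "s > 0"
    using c by (simp add: s_def)
  have cs: "c * s\<^sup>2 = 1 / 2"
    using c by (simp add: s_def power_divide)
  have "(\<integral>\<^sup>+v. ennreal (exp (- c * (norm (v::real^'n))\<^sup>2)) \<partial>lborel)
      = ennreal (\<bar>s\<bar> ^ DIM(real^'n)) * (\<integral>\<^sup>+x. ennreal (exp (- c * (norm (0 + s *\<^sub>R (x::real^'n)))\<^sup>2)) \<partial>lborel)"
    by (subst lborel_affine[of s 0]) (use s in \<open>simp_all add: nn_integral_density nn_integral_distr nn_integral_cmult\<close>)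
  also have "(\<integral>\<^sup>+x. ennreal (exp (- c * (norm (0 + s *\<^sub>R (x::real^'n)))\<^sup>2)) \<partial>lborel)
      = (\<integral>\<^sup>+x. ennreal ((2 * pi) powr (real CARD('n) / 2)) * ennreal (gauss_density (x::real^'n)) \<partial>lborel)"
  proof (intro nn_integral_cong)
    fix x :: "real^'n"
    have "- c * (norm (0 + s *\<^sub>R x))\<^sup>2 = - (norm x)\<^sup>2 / 2"
      using s cs by (simp add: power_mult_distrib mult.assoc[symmetric])
    moreover have "(2 * pi) powr (real CARD('n) / 2) * (2 * pi) powr (- real CARD('n) / 2) = 1"
      by (simp add: powr_add[symmetric])
    ultimately show "ennreal (exp (- c * (norm (0 + s *\<^sub>R x))\<^sup>2)) = ennreal ((2 * pi) powr (real CARD('n) / 2)) * ennreal (gauss_density x)"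
      by (simp add: gauss_density_def ennreal_mult'[symmetric] mult.assoc[symmetric])
  qed
  also have "\<dots> = ennreal ((2 * pi) powr (real CARD('n) / 2))"
    by (simp add: nn_integral_cmult nn_integral_gauss_density)
  finally have "(\<integral>\<^sup>+v. ennreal (exp (- c * (norm (v::real^'n))\<^sup>2)) \<partial>lborel) < \<infinity>"
    by (simp add: ennreal_mult_less_top)
  then show ?thesis
    unfolding integrable_iff_bounded by simp
qed

lemma integrable_exp_neg_square_norm_shift:
  assumes "0 < c"
  shows "integrable lborel (\<lambda>v::real^'n. exp (- c * (norm (v - a))\<^sup>2))"
proof -
  have "(\<integral>\<^sup>+v. ennreal (norm (exp (- c * (norm (v + - a))\<^sup>2))) \<partial>lborel)
      = (\<integral>\<^sup>+v. ennreal (norm (exp (- c * (norm (v::real^'n))\<^sup>2))) \<partial>lborel)"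
    by (rule nn_integral_lborel_translate[of "\<lambda>v. ennreal (norm (exp (- c * (norm v)\<^sup>2)))"]) measurable
  then show ?thesis
    using integrable_exp_neg_square_norm[OF assms] unfolding integrable_iff_bounded by simp
qed

lemma integral_lborel_translate:
  fixes f :: "'a::euclidean_space \<Rightarrow> real"
  assumes [measurable]: "f \<in> borel_measurable borel"
  shows "(\<integral>x. f (x + t) \<partial>lborel) = (\<integral>x. f x \<partial>lborel)"
  using integral_distr[of "(+) t" lborel borel f] by (simp add: lborel_distr_plus add.commute)

definition poly_gauss_conv :: "real^'n^'n \<Rightarrow> (real^'n) set \<Rightarrow> (real^'n \<Rightarrow> real) \<Rightarrow> real^'n \<Rightarrow> real" where
  "poly_gauss_conv N A p y = (\<integral>w. indicator A w * (p (w - y) * gauss_weight N (w - y)) \<partial>lborel)"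

lemma poly_gauss_conv_measurable:
  assumes [measurable]: "A \<in> sets borel" and p: "real_polynomial_function p"
  shows "poly_gauss_conv N A p \<in> borel_measurable borel"
proof -
  have [measurable]: "p \<in> borel_measurable borel"
    using p by (rule real_polynomial_function_measurable)
  show ?thesis
    unfolding poly_gauss_conv_def[abs_def] by measurable
qed

lemma
  fixes N :: "real^'n^'n"
  assumes dN: "det N \<noteq> 0" and [measurable]: "A \<in> sets borel" and p: "real_polynomial_function p"
  shows poly_gauss_conv_integrable:
      "integrable lborel (\<lambda>w. indicator A w * (p (w - y) * gauss_weight N (w - y)))"
    and poly_gauss_conv_bounded: "\<exists>B. \<forall>y. \<bar>poly_gauss_conv N A p y\<bar> \<le> B"
proof -
  have [measurable]: "p \<in> borel_measurable borel"
    using p by (rule real_polynomial_function_measurable)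
  obtain k C where k: "0 < k"
    and Ck: "\<And>v0 v. norm (v - v0) \<le> 0 \<Longrightarrow> \<bar>p v * gauss_weight N v\<bar> \<le> C * exp (- k * (norm v0)\<^sup>2)"
    using gauss_weighted_polynomial_dominated[OF dN p, where r=0] by blast
  have le: "\<bar>indicator A w * (p (w - y) * gauss_weight N (w - y))\<bar> \<le> C * exp (- k * (norm (w - y))\<^sup>2)"
    for w y :: "real^'n"
    using Ck[of "w - y" "w - y"] by (auto simp: indicator_def)
  have intC: "integrable lborel (\<lambda>w. C * exp (- k * (norm (w - y))\<^sup>2))" for y :: "real^'n"
    by (rule integrable_mult_right) (rule integrable_exp_neg_square_norm_shift[OF k])
  show int: "integrable lborel (\<lambda>w. indicator A w * (p (w - y) * gauss_weight N (w - y)))" for y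
  proof (rule Bochner_Integration.integrable_bound)
    show "integrable lborel (\<lambda>w. C * exp (- k * (norm (w - y))\<^sup>2))"
      by (rule intC)
    show "AE w in lborel. norm (indicator A w * (p (w - y) * gauss_weight N (w - y)))
        \<le> norm (C * exp (- k * (norm (w - y))\<^sup>2))"
    proof (rule AE_I2)
      fix w
      show "norm (indicator A w * (p (w - y) * gauss_weight N (w - y)))
          \<le> norm (C * exp (- k * (norm (w - y))\<^sup>2))"
        using le[of w y] abs_ge_self[of "C * exp (- k * (norm (w - y))\<^sup>2)"]
        by (simp only: real_norm_def)
    qed
  qed measurable
  have "\<bar>poly_gauss_conv N A p y\<bar> \<le> (\<integral>w. C * exp (- k * (norm (w :: real^'n))\<^sup>2) \<partial>lborel)" for y
  proof -
    have "\<bar>poly_gauss_conv N A p y\<bar> \<le> (\<integral>w. C * exp (- k * (norm (w - y))\<^sup>2) \<partial>lborel)"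
      unfolding poly_gauss_conv_def
      using int intC le
      by (intro order_trans[OF integral_abs_bound] integral_mono) (simp_all add: integrable_abs)
    also have "\<dots> = (\<integral>w. C * exp (- k * (norm (w :: real^'n))\<^sup>2) \<partial>lborel)"
      using integral_lborel_translate[of "\<lambda>w. C * exp (- k * (norm w)\<^sup>2)" "- y"] by simp
    finally show ?thesis .
  qed
  then show "\<exists>B. \<forall>y. \<bar>poly_gauss_conv N A p y\<bar> \<le> B"
    by blast
qed

lemma poly_gauss_conv_directional_derivative:
  fixes N :: "real^'n^'n"
  assumes dN: "det N \<noteq> 0" and [measurable]: "A \<in> sets borel" and p: "real_polynomial_function p"
  obtains q where "real_polynomial_function q"
    and "\<And>y t. ((\<lambda>s. poly_gauss_conv N A p (y + s *\<^sub>R e)) has_real_derivative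
        poly_gauss_conv N A q (y + t *\<^sub>R e)) (at t)"
proof -
  obtain q where q: "real_polynomial_function q"
    and q_deriv: "\<And>u t. ((\<lambda>s. p (u + s *\<^sub>R - e) * gauss_weight N (u + s *\<^sub>R - e)) has_real_derivative
        q (u + t *\<^sub>R - e) * gauss_weight N (u + t *\<^sub>R - e)) (at t)"
    using gauss_weighted_polynomial_directional_derivative[OF p, where e="- e" and N=N] by blast
  have [measurable]: "p \<in> borel_measurable borel" "q \<in> borel_measurable borel"
    using p q by (simp_all add: real_polynomial_function_measurable)
  obtain k C where k: "0 < k" and Ck: "\<And>v0 v. norm (v - v0) \<le> norm e \<Longrightarrow>
      \<bar>q v * gauss_weight N v\<bar> \<le> C * exp (- k * (norm v0)\<^sup>2)"
    using gauss_weighted_polynomial_dominated[OF dN q, where r="norm e"] by blast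
  have "\<bar>q 0 * gauss_weight N 0\<bar> \<le> C"
    using Ck[of 0 0] by simp
  then have C: "0 \<le> C"
    by (meson abs_ge_zero order_trans)
  have "((\<lambda>s. poly_gauss_conv N A p (y + s *\<^sub>R e)) has_real_derivative
      poly_gauss_conv N A q (y + t0 *\<^sub>R e)) (at t0)" for y t0
    unfolding poly_gauss_conv_def
  proof (rule has_real_derivative_integral[where \<delta>=1 and g="\<lambda>w. C * exp (- k * (norm (w - (y + t0 *\<^sub>R e)))\<^sup>2)"])
    fix w :: "real^'n" and t :: real assume t: "\<bar>t - t0\<bar> < 1"
    have shift: "(w - y) + s *\<^sub>R - e = w - (y + s *\<^sub>R e)" for s
      by (simp add: algebra_simps)
    show "((\<lambda>s. indicator A w * (p (w - (y + s *\<^sub>R e)) * gauss_weight N (w - (y + s *\<^sub>R e))))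
        has_real_derivative indicator A w * (q (w - (y + t *\<^sub>R e)) * gauss_weight N (w - (y + t *\<^sub>R e)))) (at t)"
      using DERIV_cmult[OF q_deriv[of "w - y" t], of "indicator A w"] by (simp only: shift)
    have "norm ((w - (y + t *\<^sub>R e)) - (w - (y + t0 *\<^sub>R e))) \<le> norm e"
      using t by (simp add: algebra_simps mult_left_le abs_minus_commute flip: scaleR_diff_left)
    then show "\<bar>indicator A w * (q (w - (y + t *\<^sub>R e)) * gauss_weight N (w - (y + t *\<^sub>R e)))\<bar>
        \<le> C * exp (- k * (norm (w - (y + t0 *\<^sub>R e)))\<^sup>2)"
      using Ck C by (auto simp: indicator_def)
  next
    show "integrable lborel (\<lambda>w. C * exp (- k * (norm (w - (y + t0 *\<^sub>R e)))\<^sup>2))"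
      by (rule integrable_mult_right) (rule integrable_exp_neg_square_norm_shift[OF k])
  qed (use poly_gauss_conv_integrable[OF dN _ p] in auto)
  with q that show ?thesis
    by blast
qed

section \<open>Derivatives of Gaussian mixtures\<close>

lemma has_real_derivative_expectation_translate:
  fixes F F' :: "'b::real_normed_vector \<Rightarrow> real" and X :: "'a \<Rightarrow> 'b"
  assumes M: "prob_space M" and [measurable]: "X \<in> borel_measurable M"
    and [measurable]: "F \<in> borel_measurable borel" "F' \<in> borel_measurable borel"
    and F: "\<And>y. \<bar>F y\<bar> \<le> B" and F': "\<And>y. \<bar>F' y\<bar> \<le> B'"
    and der: "\<And>y t. ((\<lambda>s. F (y + s *\<^sub>R e)) has_real_derivative F' (y + t *\<^sub>R e)) (at t)"
  shows "((\<lambda>s. \<integral>\<omega>. F (y + s *\<^sub>R e + X \<omega>) \<partial>M) has_real_derivative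
      (\<integral>\<omega>. F' (y + t *\<^sub>R e + X \<omega>) \<partial>M)) (at t)"
proof -
  interpret prob_space M
    by (rule M)
  show ?thesis
  proof (rule has_real_derivative_integral[where \<delta>=1 and g="\<lambda>_. B'"])
    show "integrable M (\<lambda>\<omega>. F (y + t *\<^sub>R e + X \<omega>))"
      by (rule integrable_const_bound[where B=B]) (simp_all add: F)
    fix \<omega> s
    show "((\<lambda>s. F (y + s *\<^sub>R e + X \<omega>)) has_real_derivative F' (y + s *\<^sub>R e + X \<omega>)) (at s)"
      using der[of "y + X \<omega>" s] by (simp add: ac_simps)
    show "\<bar>F' (y + s *\<^sub>R e + X \<omega>)\<bar> \<le> B'"
      by (rule F')
  qed simp_all
qed

lemma pderiv_coord_eqI:
  assumes "\<And>y. ((\<lambda>s. f (y + s *\<^sub>R axis i 1)) has_real_derivative f' y) (at 0)"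
  shows "pderiv_coord i f = f'"
  using assms by (simp add: pderiv_coord_def DERIV_imp_deriv fun_eq_iff)

lemma pderiv_coord_poly_gauss_conv:
  fixes N R :: "real^'n^'n"
  assumes dN: "det N \<noteq> 0" and A: "A \<in> sets borel" and p: "real_polynomial_function p"
  obtains q where "real_polynomial_function q"
    and "pderiv_coord i (poly_gauss_conv N A p) = poly_gauss_conv N A q"
    and "pderiv_coord i (gauss_mixture R (poly_gauss_conv N A p)) = gauss_mixture R (poly_gauss_conv N A q)"
proof -
  let ?e = "axis i 1 :: real^'n"
  obtain q where q: "real_polynomial_function q" and der: "\<And>y t.
      ((\<lambda>s. poly_gauss_conv N A p (y + s *\<^sub>R ?e)) has_real_derivative poly_gauss_conv N A q (y + t *\<^sub>R ?e)) (at t)"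
    using poly_gauss_conv_directional_derivative[OF dN A p, where e="?e"] by blast
  obtain B B' where "\<And>y. \<bar>poly_gauss_conv N A p y\<bar> \<le> B" "\<And>y. \<bar>poly_gauss_conv N A q y\<bar> \<le> B'"
    using poly_gauss_conv_bounded[OF dN A p] poly_gauss_conv_bounded[OF dN A q] by blast
  note mixture_der = has_real_derivative_expectation_translate[OF prob_space_std_gauss _
      poly_gauss_conv_measurable[OF A p] poly_gauss_conv_measurable[OF A q] this der]
  show ?thesis
  proof (rule that[OF q])
    show "pderiv_coord i (poly_gauss_conv N A p) = poly_gauss_conv N A q"
      by (rule pderiv_coord_eqI) (use der[of _ 0] in simp)
    show "pderiv_coord i (gauss_mixture R (poly_gauss_conv N A p)) = gauss_mixture R (poly_gauss_conv N A q)"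
      by (rule pderiv_coord_eqI) (use mixture_der[of "(*v) R" _ 0] in \<open>simp add: gauss_mixture_def\<close>)
  qed
qed

lemma third_pderivs_poly_gauss_conv:
  fixes N R :: "real^'n^'n"
  assumes dN: "det N \<noteq> 0" and A: "A \<in> sets borel" and p: "real_polynomial_function p"
  obtains Q where "\<And>k i j. real_polynomial_function (Q k i j)"
    and "\<And>k i j. pderiv_coord k (pderiv_coord i (pderiv_coord j (poly_gauss_conv N A p)))
      = poly_gauss_conv N A (Q k i j)"
    and "\<And>k i j. pderiv_coord k (pderiv_coord i (pderiv_coord j (gauss_mixture R (poly_gauss_conv N A p))))
      = gauss_mixture R (poly_gauss_conv N A (Q k i j))"
proof -
  have "\<exists>q. real_polynomial_function q
    \<and> pderiv_coord k (pderiv_coord i (pderiv_coord j (poly_gauss_conv N A p))) = poly_gauss_conv N A q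
    \<and> pderiv_coord k (pderiv_coord i (pderiv_coord j (gauss_mixture R (poly_gauss_conv N A p))))
        = gauss_mixture R (poly_gauss_conv N A q)" for k i j
  proof -
    obtain q1 where q1: "real_polynomial_function q1"
      "pderiv_coord j (poly_gauss_conv N A p) = poly_gauss_conv N A q1"
      "pderiv_coord j (gauss_mixture R (poly_gauss_conv N A p)) = gauss_mixture R (poly_gauss_conv N A q1)"
      using pderiv_coord_poly_gauss_conv[OF dN A p] by metis
    obtain q2 where q2: "real_polynomial_function q2"
      "pderiv_coord i (poly_gauss_conv N A q1) = poly_gauss_conv N A q2"
      "pderiv_coord i (gauss_mixture R (poly_gauss_conv N A q1)) = gauss_mixture R (poly_gauss_conv N A q2)"
      using pderiv_coord_poly_gauss_conv[OF dN A q1(1)] by metis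
    obtain q3 where q3: "real_polynomial_function q3"
      "pderiv_coord k (poly_gauss_conv N A q2) = poly_gauss_conv N A q3"
      "pderiv_coord k (gauss_mixture R (poly_gauss_conv N A q2)) = gauss_mixture R (poly_gauss_conv N A q3)"
      using pderiv_coord_poly_gauss_conv[OF dN A q2(1)] by metis
    show ?thesis
      using q1 q2 q3 by auto
  qed
  then show ?thesis
    using that by metis
qed

lemma integrable_gauss_mixture:
  fixes F :: "real^'n \<Rightarrow> real" and R :: "real^'n^'n"
  assumes [measurable]: "F \<in> borel_measurable borel" and "\<And>y. \<bar>F y\<bar> \<le> B"
  shows "integrable std_gauss (\<lambda>\<xi>. F (x + R *v \<xi>))"
proof -
  interpret prob_space "std_gauss :: (real^'n) measure"
    by (rule prob_space_std_gauss)
  show ?thesis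
    by (rule integrable_const_bound[where B=B]) (simp_all add: assms(2))
qed

section \<open>Proof of the theorem\<close>

lemma phi_eq_poly_gauss_conv:
  fixes S :: "real^'n^'n"
  assumes dS: "det S \<noteq> 0" and A[measurable]: "A \<in> sets borel"
  obtains c where "(\<lambda>y. phi A y S) = poly_gauss_conv (matrix_inv S) A (\<lambda>_. c)"
proof -
  let ?N = "matrix_inv S" and ?c0 = "(2 * pi) powr (- real CARD('n) / 2)"
  obtain c where c: "0 < c" "\<And>A x. A \<in> sets borel \<Longrightarrow>
      ephi A x S = ennreal c * (\<integral>\<^sup>+w. ennreal (gauss_density (?N *v (w - x))) * indicator A w \<partial>lborel)"
    using ephi_density[OF dS] by blast
  have dN: "det ?N \<noteq> 0"
    using dS by (simp add: det_matrix_inv)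
  have const: "real_polynomial_function (\<lambda>_. ?c0)"
    by (rule real_polynomial_function.intros(2))
  have "phi A y S = poly_gauss_conv ?N A (\<lambda>_. c * ?c0) y" for y
  proof -
    have "(\<integral>\<^sup>+w. ennreal (gauss_density (?N *v (w - y))) * indicator A w \<partial>lborel)
        = (\<integral>\<^sup>+w. ennreal (indicator A w * (?c0 * gauss_weight ?N (w - y))) \<partial>lborel)"
      by (intro nn_integral_cong) (simp add: gauss_density_def gauss_weight_def indicator_def)
    also have "\<dots> = ennreal (poly_gauss_conv ?N A (\<lambda>_. ?c0) y)"
      unfolding poly_gauss_conv_def
      by (rule nn_integral_eq_integral[OF poly_gauss_conv_integrable[OF dN A const]])
         (simp add: indicator_def gauss_weight_def)
    finally have "ephi A y S = ennreal c * ennreal (poly_gauss_conv ?N A (\<lambda>_. ?c0) y)"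
      by (simp add: c(2)[OF A])
    moreover have "0 \<le> poly_gauss_conv ?N A (\<lambda>_. ?c0) y"
      unfolding poly_gauss_conv_def
      by (intro Bochner_Integration.integral_nonneg) (simp add: indicator_def gauss_weight_def)
    ultimately have "phi A y S = c * poly_gauss_conv ?N A (\<lambda>_. ?c0) y"
      using c(1) by (simp add: phi_eq_enn2real_ephi ennreal_mult'[symmetric])
    also have "\<dots> = poly_gauss_conv ?N A (\<lambda>_. c * ?c0) y"
      unfolding poly_gauss_conv_def by (simp add: mult_ac flip: integral_mult_right_zero)
    finally show ?thesis .
  qed
  then show ?thesis
    by (intro that[of "c * ?c0"]) (simp add: fun_eq_iff)
qed

lemma expectation_le_SUP:
  fixes f :: "'b \<Rightarrow> real" and g :: "'a \<Rightarrow> 'b"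
  assumes "prob_space M" and int: "integrable M (\<lambda>\<omega>. f (g \<omega>))"
  shows "ereal (\<integral>\<omega>. f (g \<omega>) \<partial>M) \<le> (SUP y. ereal (f y))"
proof (cases "(SUP y. ereal (f y)) = \<infinity>")
  case False
  interpret prob_space M
    by fact
  have le: "ereal (f y) \<le> (SUP y. ereal (f y))" for y
    by (rule SUP_upper) simp
  then have "(SUP y. ereal (f y)) \<noteq> - \<infinity>"
    by (metis MInfty_neq_ereal(1) ereal_infty_less_eq(2))
  with False obtain m where m: "(SUP y. ereal (f y)) = ereal m"
    by (cases "SUP y. ereal (f y)") auto
  have "(\<integral>\<omega>. f (g \<omega>) \<partial>M) \<le> (\<integral>\<omega>. m \<partial>M)"
    using le m by (intro integral_mono[OF int]) simp_all
  also have "\<dots> = m"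
    by (simp add: prob_space)
  finally show ?thesis
    using m by simp
qed simp

lemma third_deriv_sum_le_SUP:
  fixes S S' R :: "real^'n^'n"
  assumes sym: "sym_mat S" "sym_mat S'" "sym_mat R" and det: "det S \<noteq> 0" "det S' \<noteq> 0"
    and eq: "S ** S = S' ** S' + R ** R" and A: "A \<in> sets borel"
  shows "ereal (third_deriv_sum A S x) \<le> (SUP y. ereal (third_deriv_sum A S' y))"
proof -
  let ?N = "matrix_inv S'"
  have dN: "det ?N \<noteq> 0"
    using det(2) by (simp add: det_matrix_inv)
  obtain c where phi': "(\<lambda>y. phi A y S') = poly_gauss_conv ?N A (\<lambda>_. c)"
    using phi_eq_poly_gauss_conv[OF det(2) A] by blast
  obtain Q where Q: "\<And>k i j. real_polynomial_function (Q k i j)"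
    and deriv': "\<And>k i j. pderiv_coord k (pderiv_coord i (pderiv_coord j (\<lambda>y. phi A y S')))
      = poly_gauss_conv ?N A (Q k i j)"
    and deriv: "\<And>k i j. pderiv_coord k (pderiv_coord i (pderiv_coord j (\<lambda>y. phi A y S)))
      = gauss_mixture R (poly_gauss_conv ?N A (Q k i j))"
    using third_pderivs_poly_gauss_conv[OF dN A real_polynomial_function.intros(2), of c R]
    unfolding phi_gauss_mixture[OF sym det eq A] phi' by blast
  have int: "integrable std_gauss (\<lambda>\<xi>. \<bar>poly_gauss_conv ?N A (Q k i j) (x + R *v \<xi>)\<bar>)" for k i j
  proof -
    obtain B where "\<And>y. \<bar>poly_gauss_conv ?N A (Q k i j) y\<bar> \<le> B"
      using poly_gauss_conv_bounded[OF dN A Q] by blast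
    then show ?thesis
      using poly_gauss_conv_measurable[OF A Q] by (intro integrable_gauss_mixture[where B=B]) auto
  qed
  have "third_deriv_sum A S x
      = (\<Sum>k\<in>UNIV. \<Sum>i\<in>UNIV. \<Sum>j\<in>UNIV. \<bar>gauss_mixture R (poly_gauss_conv ?N A (Q k i j)) x\<bar>)"
    by (simp add: third_deriv_sum_def deriv)
  also have "\<dots> \<le> (\<Sum>k\<in>UNIV. \<Sum>i\<in>UNIV. \<Sum>j\<in>UNIV.
      \<integral>\<xi>. \<bar>poly_gauss_conv ?N A (Q k i j) (x + R *v \<xi>)\<bar> \<partial>std_gauss)"
    unfolding gauss_mixture_def by (intro sum_mono integral_abs_bound)
  also have "\<dots> = (\<integral>\<xi>. third_deriv_sum A S' (x + R *v \<xi>) \<partial>std_gauss)"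
    using int by (simp add: third_deriv_sum_def deriv')
  finally have "ereal (third_deriv_sum A S x) \<le> ereal (\<integral>\<xi>. third_deriv_sum A S' (x + R *v \<xi>) \<partial>std_gauss)"
    by simp
  also have "\<dots> \<le> (SUP y. ereal (third_deriv_sum A S' y))"
    using int prob_space_std_gauss by (intro expectation_le_SUP) (simp_all add: third_deriv_sum_def deriv')
  finally show ?thesis .
qed

lemma hyperrects_sets_borel:
  fixes A :: "(real^'n) set"
  assumes "A \<in> hyperrects"
  shows "A \<in> sets borel"
proof -
  obtain a b :: "'n \<Rightarrow> ereal" where A: "A = {x. \<forall>j. a j < ereal (x $ j) \<and> ereal (x $ j) \<le> b j}"
    using assms by (auto simp: hyperrects_def)
  have "{x::real^'n. \<forall>j. a j < ereal (x $ j) \<and> ereal (x $ j) \<le> b j} \<in> sets borel"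
    by measurable
  then show ?thesis
    using A by simp
qed

theorem lemmaC7:
  fixes A :: "(real ^ 'n) set" and \<Gamma>1 \<Gamma>2 :: "real ^ 'n ^ 'n" and x :: "real ^ 'n"
  assumes "A \<in> hyperrects"
    and "sym_mat \<Gamma>1" and "sym_mat \<Gamma>2"
    and "loewner_ge \<Gamma>1 \<Gamma>2" and "pd_mat \<Gamma>2"
  shows "ereal (third_deriv_sum A (psd_sqrt \<Gamma>1) x)
           \<le> (SUP y. ereal (third_deriv_sum A (psd_sqrt \<Gamma>2) y))"
proof -
  have pd1: "pd_mat \<Gamma>1"
    using assms(2,4,5) by (rule pd_mat_if_loewner_ge)
  have psd: "psd_mat \<Gamma>1" "psd_mat \<Gamma>2" "psd_mat (\<Gamma>1 - \<Gamma>2)"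
    using pd1 assms(4,5) by (simp_all add: pd_mat_imp_psd_mat loewner_ge_def)
  let ?R = "psd_sqrt (\<Gamma>1 - \<Gamma>2)"
  have "psd_sqrt \<Gamma>1 ** psd_sqrt \<Gamma>1 = psd_sqrt \<Gamma>2 ** psd_sqrt \<Gamma>2 + ?R ** ?R"
    using psd by (simp add: psd_sqrt_square)
  moreover have "sym_mat (psd_sqrt \<Gamma>1)" "sym_mat (psd_sqrt \<Gamma>2)" "sym_mat ?R"
    using psd_mat_psd_sqrt[OF psd(1)] psd_mat_psd_sqrt[OF psd(2)] psd_mat_psd_sqrt[OF psd(3)]
    by (simp_all add: psd_mat_def)
  ultimately show ?thesis
    using det_psd_sqrt_nz[OF pd1] det_psd_sqrt_nz[OF assms(5)] hyperrects_sets_borel[OF assms(1)]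
    by (intro third_deriv_sum_le_SUP) simp_all
qed

end
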